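(* Let $n_0 = 3\cdot 5\cdot 7\cdot 11\cdot 13\cdot 17\cdot 19\cdot 23 = 111546435$. For every integer $m$ with $2\le m<n_0$, the partition $G(m)$ of $\{2,\dots,m\}$ produced by the natural greedy algorithm is $$G(m)=\{S_{j,m} : j\ge 1,\ S_{j,m}\ne\emptyset\},$$ whereas $$G(n_0)=\{\,S_{1,n_0}\cup\{n_0\},\ S_{2,n_0}\setminus\{n_0\}\,\}\cup\{S_{j,n_0} : j\ge 3,\ S_{j,n_0}\neq\emptyset\}.$$
   Context: Let $p_i$ denote the $i$-th prime ($p_1=2$, $p_2=3,\dots$). For $i\ge1$ and a positive integer $n$, $S_{i,n}$ is the set of positive integers $m\le n$ with $p_i\mid m$ and $p_j\nmid m$ for all $j<i$ (i.e. the integers in $[2,n]$ whose smallest prime factor is $p_i$). Two distinct integers $a,b\ge 2$ are friends if $\gcd(a,b)>1$ and enemies if $\gcd(a,b)=1$. Given a partition of a finite set of integers $\ge2$, a pair $\{a,b\}$ of distinct elements is in conflict if $a,b$ are enemies in the same class, or friends in different classes. The natural greedy algorithm produces for each $n\ge 2$ a partition $G(n)$ of $\{2,\dots,n\}$, with its classes indexed, as follows. $G(2)=\{\{2\}\}$. For $n\ge3$, let $G(n-1)=\{P_1,\dots,P_M\}$, with the classes indexed in order of creation (equivalently, by increasing smallest element). The options are: (option $0$) add $\{n\}$ as a new class; (option $j$, $1\le j\le M$) replace $P_j$ by $P_j\cup\{n\}$. For each option count the conflicts among the pairs $\{a,n\}$, $2\le a<n$, in the resulting partition of $\{2,\dots,n\}$.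 Choose the option with the fewest such conflicts; if there are several, choose the one with the smallest option index. The resulting partition is $G(n)$. *)

theory Defs
  imports "HOL-Computational_Algebra.Primes" "HOL-Library.Infinite_Set"
begin

(* 1-based: nth_prime 1 = 2. The value at 0 is junk and never used. *)
definition nth_prime :: "nat \<Rightarrow> nat" where
  "nth_prime i = enumerate {p. prime p} (i - 1)"

definition S :: "nat \<Rightarrow> nat \<Rightarrow> nat set" where
  "S i n = {m. 1 \<le> m \<and> m \<le> n \<and> nth_prime i dvd m \<and>
               (\<forall>j. 1 \<le> j \<and> j < i \<longrightarrow> \<not> nth_prime j dvd m)}"

definition friends :: "nat \<Rightarrow> nat \<Rightarrow> bool" where
  "friends a b \<longleftrightarrow> 2 \<le> a \<and> 2 \<le> b \<and> a \<noteq> b \<and> gcd a b > 1"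

definition enemies :: "nat \<Rightarrow> nat \<Rightarrow> bool" where
  "enemies a b \<longleftrightarrow> 2 \<le> a \<and> 2 \<le> b \<and> a \<noteq> b \<and> gcd a b = 1"

definition in_conflict :: "nat set set \<Rightarrow> nat \<Rightarrow> nat \<Rightarrow> bool" where
  "in_conflict P a b \<longleftrightarrow>
     enemies a b \<and> (\<exists>C\<in>P. a \<in> C \<and> b \<in> C) \<or>
     friends a b \<and> (\<exists>C\<in>P. \<exists>D\<in>P. C \<noteq> D \<and> a \<in> C \<and> b \<in> D)"

(* An indexed partition is the list of its classes in order of creation;
   class number j (counting from 1) is the list element at position j - 1. *)
definition apply_option :: "nat \<Rightarrow> nat set list \<Rightarrow> nat \<Rightarrow> nat set list" where
  "apply_option n Ps k =
     (if k = 0 then Ps @ [{n}] else Ps[k - 1 := Ps ! (k - 1) \<union> {n}])"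

definition option_cost :: "nat \<Rightarrow> nat set list \<Rightarrow> nat \<Rightarrow> nat" where
  "option_cost n Ps k =
     card {a. 2 \<le> a \<and> a < n \<and> in_conflict (set (apply_option n Ps k)) a n}"

definition best_option :: "nat \<Rightarrow> nat set list \<Rightarrow> nat" where
  "best_option n Ps =
     (LEAST k. k \<le> length Ps \<and>
               (\<forall>l \<le> length Ps. option_cost n Ps k \<le> option_cost n Ps l))"

(* Only the values at n \<ge> 2 are meaningful. *)
fun greedy :: "nat \<Rightarrow> nat set list" where
  "greedy 0 = []"
| "greedy (Suc n) =
     (if n = 0 then []
      else if n = 1 then [{2}]
      else apply_option (Suc n) (greedy n) (best_option (Suc n) (greedy n)))"

definition G :: "nat \<Rightarrow> nat set set" where
  "G n = set (greedy n)"

definition n0 :: nat where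
  "n0 = 3 * 5 * 7 * 11 * 13 * 17 * 19 * 23"

end

theory Submission
  imports Defs "HOL-Number_Theory.Totient" "HOL-Library.Code_Binary_Nat"
begin

text \<open>
  Let \<open>N < n0\<close> be composite with smallest prime factor \<open>q\<close>, and suppose the classes so far are sorted by
  smallest prime factor. All elements of the class of \<open>q\<close> are friends of \<open>N\<close>, and the classes of larger
  primes are no bigger, so \<open>N\<close> joins the class of \<open>q\<close> unless for some prime \<open>p < q\<close> the friends of \<open>N\<close>
  in the class of \<open>p\<close> outnumber its enemies there by at least the size of the class of \<open>q\<close>.
  Dividing by \<open>p\<close> turns the class of \<open>p\<close> into the numbers \<open>k \<le> x = (N - 1) div p\<close> without
  prime factor below \<open>p\<close>, the enemies being those coprime to \<open>N\<close>.

  For \<open>p = 2\<close> there are \<open>totient N / 2\<close> enemies. If \<open>3\<close> divides \<open>N\<close>, then \<open>N\<close> leaves the class of \<open>3\<close>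
  exactly when \<open>totient N \<le> N / 3\<close>, which needs at least eight distinct odd prime factors, so that \<open>n0\<close> is
  the first such number. For \<open>p = 3\<close> Legendre's sieve suffices. For \<open>p \<ge> 5\<close> the enemies are in the majority:
  if \<open>x < p * q\<close>, the friends are the prime factors of \<open>N\<close>, of which there are at most two, while \<open>1\<close> and \<open>p\<close>
  are enemies; otherwise \<open>p\<^sup>3 < n0\<close>, and the friends are few by the union bound over the prime factors of \<open>N\<close>.
\<close>

section \<open>Sifted sets\<close>

definition sift :: "nat set \<Rightarrow> nat \<Rightarrow> nat set" where
  "sift Q y = {k. 1 \<le> k \<and> k \<le> y \<and> (\<forall>l\<in>Q. \<not> l dvd k)}"

lemma finite_sift [simp, intro]: "finite (sift Q y)"
  by (rule finite_subset[of _ "{..y}"]) (auto simp: sift_def)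

lemma sift_antimono: "Q \<subseteq> R \<Longrightarrow> sift R y \<subseteq> sift Q y"
  by (auto simp: sift_def)

lemma card_sift_antimono: "Q \<subseteq> R \<Longrightarrow> card (sift R y) \<le> card (sift Q y)"
  by (intro card_mono sift_antimono finite_sift)

text \<open>Dividing a multiple of \<open>l\<close> by \<open>l\<close> does not affect divisibility
  by the primes of \<open>Q\<close>, because \<open>l\<close> is a prime outside
  \<open>Q\<close>.\<close>

lemma multiples_in_sift:
  assumes "prime l" "l \<notin> Q" "\<And>q. q \<in> Q \<Longrightarrow> prime q"
  shows "{k \<in> sift Q y. l dvd k} = (*) l ` sift Q (y div l)"
proof (intro set_eqI iffI)
  fix k assume "k \<in> {k \<in> sift Q y. l dvd k}"
  then obtain m where m: "k = l * m" and k: "k \<in> sift Q y" by auto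
  have "l > 0" using assms(1) prime_gt_0_nat by blast
  with m k have "m \<in> sift Q (y div l)"
    by (auto simp: sift_def less_eq_div_iff_mult_less_eq mult.commute)
  with m show "k \<in> (*) l ` sift Q (y div l)" by blast
next
  fix k assume "k \<in> (*) l ` sift Q (y div l)"
  then obtain m where m: "k = l * m" "m \<in> sift Q (y div l)" by blast
  have "l > 0" using assms(1) prime_gt_0_nat by blast
  moreover have "\<not> q dvd k" if "q \<in> Q" for q
  proof
    assume "q dvd k"
    with that m have "q dvd l" by (auto simp: sift_def assms prime_dvd_mult_iff)
    with that assms show False using primes_dvd_imp_eq by blast
  qed
  ultimately show "k \<in> {k \<in> sift Q y. l dvd k}"
    using m by (auto simp: sift_def less_eq_div_iff_mult_less_eq mult.commute)
qed

lemma card_multiples_in_sift: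
  assumes "prime l" "l \<notin> Q" "\<And>q. q \<in> Q \<Longrightarrow> prime q"
  shows "card {k \<in> sift Q y. l dvd k} = card (sift Q (y div l))"
proof -
  have "inj_on ((*) l) (sift Q (y div l))" using assms(1) by (intro inj_onI) auto
  thus ?thesis using multiples_in_sift[OF assms] card_image by metis
qed

text \<open>This is Buchstab's identity, the recursion behind Legendre's sieve.\<close>

lemma card_sift_insert:
  assumes "prime l" "l \<notin> Q" "\<And>q. q \<in> Q \<Longrightarrow> prime q"
  shows "card (sift Q y) = card (sift (insert l Q) y) + card (sift Q (y div l))"
proof -
  have "sift Q y = sift (insert l Q) y \<union> {k \<in> sift Q y. l dvd k}"
    by (auto simp: sift_def)
  also have "card \<dots> = card (sift (insert l Q) y) + card {k \<in> sift Q y. l dvd k}"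
    by (rule card_Un_disjoint) (auto simp: sift_def)
  finally show ?thesis by (simp only: card_multiples_in_sift[OF assms])
qed

lemma card_sift_union_bound:
  assumes "finite R" "\<And>q. q \<in> Q \<union> R \<Longrightarrow> prime q" "Q \<inter> R = {}"
  shows "card (sift Q x) \<le> card (sift (Q \<union> R) x) + (\<Sum>l\<in>R. card (sift Q (x div l)))"
proof -
  have "sift Q x \<subseteq> sift (Q \<union> R) x \<union> (\<Union>l\<in>R. {k \<in> sift Q x. l dvd k})"
    by (auto simp: sift_def)
  hence "card (sift Q x) \<le> card (sift (Q \<union> R) x \<union> (\<Union>l\<in>R. {k \<in> sift Q x. l dvd k}))"
    by (intro card_mono) (auto simp: assms(1))
  also have "\<dots> \<le> card (sift (Q \<union> R) x) + card (\<Union>l\<in>R. {k \<in> sift Q x. l dvd k})"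
    by (rule card_Un_le)
  also have "card (\<Union>l\<in>R. {k \<in> sift Q x. l dvd k}) \<le> (\<Sum>l\<in>R. card {k \<in> sift Q x. l dvd k})"
    by (rule card_UN_le) (rule assms(1))
  also have "\<dots> = (\<Sum>l\<in>R. card (sift Q (x div l)))"
    by (intro sum.cong refl card_multiples_in_sift) (use assms in auto)
  finally show ?thesis by simp
qed

lemma card_odd_upto: "card (sift {2} y) = (y + 1) div 2"
proof (induction y)
  case (Suc y)
  have "sift {2} (Suc y) = (if even (Suc y) then sift {2} y else insert (Suc y) (sift {2} y))"
    by (auto simp: sift_def le_Suc_eq)
  moreover have "Suc y \<notin> sift {2} y" by (simp add: sift_def)
  ultimately show ?case using Suc by auto
qed (simp add: sift_def)

lemma card_odd_upto_bounds:
  "real y / 2 \<le> card (sift {2} y)" "card (sift {2} y) \<le> (real y + 1) / 2"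
proof -
  define h where "h = card (sift {2} y)"
  have "y \<le> 2 * h" "2 * h \<le> y + 1" unfolding h_def card_odd_upto by presburger+
  hence "real y \<le> real (2 * h)" "real (2 * h) \<le> real (y + 1)" by (simp_all only: of_nat_le_iff)
  thus "real y / 2 \<le> h" "h \<le> (real y + 1) / 2" by simp_all
qed

text \<open>The odd numbers up to \<open>y\<close> are counted with error at most \<open>1 / 2\<close>, and every further prime doubles the error.\<close>

lemma legendre_sieve:
  assumes "finite R" "\<And>l. l \<in> R \<Longrightarrow> prime l" "2 \<notin> R"
  shows "y \<ge> 0 \<Longrightarrow> \<bar>real (card (sift (insert 2 R) (nat \<lfloor>y\<rfloor>))) - y / 2 * (\<Prod>l\<in>R. 1 - 1 / real l)\<bar>
           \<le> 2 ^ card R / 2"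
  using assms
proof (induction R arbitrary: y rule: finite_induct)
  case empty
  define m where "m = nat \<lfloor>y\<rfloor>"
  have "real m \<le> y" "y < real m + 1" unfolding m_def using empty by linarith+
  moreover have "real ((m + 1) div 2) = (if even m then real m / 2 else (real m + 1) / 2)"
    by (auto simp: real_of_nat_div elim!: evenE oddE)
  ultimately show ?case unfolding m_def[symmetric]
    by (simp add: card_odd_upto abs_le_iff add_divide_distrib)
next
  case (insert l R)
  have l: "prime l" "l > 0" using insert.prems by (auto intro: prime_gt_0_nat)
  \<comment> \<open>Nested floors collapse. Taking \<open>y\<close> real lets the main term pass
    from \<open>y\<close> to \<open>y / l\<close> without rounding.\<close>
  have div: "nat \<lfloor>y\<rfloor> div l = nat \<lfloor>y / real l\<rfloor>"
    using floor_divide_real_eq_div[of "int l" y] insert.prems(1) by (simp add: nat_div_distrib)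
  have "card (sift (insert 2 R) (nat \<lfloor>y\<rfloor>))
      = card (sift (insert l (insert 2 R)) (nat \<lfloor>y\<rfloor>)) + card (sift (insert 2 R) (nat \<lfloor>y\<rfloor> div l))"
    by (rule card_sift_insert) (use insert in auto)
  hence "real (card (sift (insert 2 (insert l R)) (nat \<lfloor>y\<rfloor>)))
     = real (card (sift (insert 2 R) (nat \<lfloor>y\<rfloor>))) - real (card (sift (insert 2 R) (nat \<lfloor>y / real l\<rfloor>)))"
    by (simp add: insert_commute div)
  moreover have "\<bar>real (card (sift (insert 2 R) (nat \<lfloor>y\<rfloor>))) - y / 2 * (\<Prod>l\<in>R. 1 - 1 / real l)\<bar> \<le> 2 ^ card R / 2"
    by (rule insert.IH) (use insert in auto)
  moreover have "\<bar>real (card (sift (insert 2 R) (nat \<lfloor>y / l\<rfloor>))) - (y / l) / 2 * (\<Prod>l\<in>R. 1 - 1 / real l)\<bar> \<le> 2 ^ card R / 2"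
    by (rule insert.IH) (use insert in auto)
  moreover have "y / 2 * (\<Prod>l\<in>insert l R. 1 - 1 / real l) = y / 2 * (\<Prod>l\<in>R. 1 - 1 / real l) - (y / l) / 2 * (\<Prod>l\<in>R. 1 - 1 / real l)"
    using insert l by (simp add: field_simps)
  moreover have "2 ^ card (insert l R) / 2 = (2 ^ card R / 2 + 2 ^ card R / 2 :: real)" using insert by simp
  ultimately show ?case unfolding abs_le_iff by linarith
qed

text \<open>The primes of \<open>W\<close> are sieved exactly, those of \<open>L\<close> and
  \<open>T\<close> enter through the union bound. The conclusion says that \<open>T\<close> removes
  at most half of \<open>sift (W \<union> L) x\<close>; \<open>ineq\<close> compares twice the upper
  bound for the number removed with the lower bound for the size of that set.\<close>

lemma sieve_majority:
  fixes c e :: real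
  assumes W: "\<And>y. y \<ge> 0 \<Longrightarrow> \<bar>real (card (sift W (nat \<lfloor>y\<rfloor>))) - c * y\<bar> \<le> e"
    and fin: "finite L" "finite T"
    and prime: "\<And>q. q \<in> W \<union> L \<union> T \<Longrightarrow> prime q"
    and disj: "W \<inter> L = {}" "(W \<union> L) \<inter> T = {}"
    and ineq: "e * (1 + card L + 2 * card T) \<le> c * x * (1 - (\<Sum>l\<in>L. 1 / l) - 2 * (\<Sum>t\<in>T. 1 / t))"
  shows "card (sift (W \<union> L) x) \<le> 2 * card (sift (W \<union> L \<union> T) x)"
proof -
  have div: "x div l = nat \<lfloor>real x / real l\<rfloor>" for l
    by (simp add: floor_divide_of_nat_eq)
  have up: "real (card (sift W (x div l))) \<le> c * x * (1 / l) + e" for l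
    using W[of "real x / l"] by (simp add: div abs_le_iff)
  have lo: "c * x - e \<le> card (sift W x)"
    using W[of "real x"] by (simp add: abs_le_iff)
  have sum_up: "(\<Sum>l\<in>K. real (card (sift W (x div l)))) \<le> c * x * (\<Sum>l\<in>K. 1 / l) + e * card K" for K
  proof -
    have "(\<Sum>l\<in>K. real (card (sift W (x div l)))) \<le> (\<Sum>l\<in>K. c * x * (1 / l) + e)"
      by (intro sum_mono up)
    thus ?thesis by (simp only: sum.distrib sum_distrib_left) (simp add: mult.commute)
  qed
  have 1: "real (card (sift W x)) \<le> card (sift (W \<union> L) x) + (\<Sum>l\<in>L. real (card (sift W (x div l))))"
    using card_sift_union_bound[of L W x] fin prime disj
    by (simp flip: of_nat_sum of_nat_add del: of_nat_sum of_nat_add)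
  have "card (sift (W \<union> L) x) \<le> card (sift (W \<union> L \<union> T) x) + (\<Sum>t\<in>T. card (sift (W \<union> L) (x div t)))"
    using card_sift_union_bound[of T "W \<union> L" x] fin prime disj by auto
  \<comment> \<open>Forgetting \<open>L\<close> enlarges the counts but makes the estimate
    \<open>W\<close> applicable.\<close>
  also have "(\<Sum>t\<in>T. card (sift (W \<union> L) (x div t))) \<le> (\<Sum>t\<in>T. card (sift W (x div t)))"
    by (intro sum_mono card_sift_antimono) auto
  finally have "card (sift (W \<union> L) x) \<le> card (sift (W \<union> L \<union> T) x) + (\<Sum>t\<in>T. card (sift W (x div t)))"
    by simp
  hence 2: "real (card (sift (W \<union> L) x)) \<le> card (sift (W \<union> L \<union> T) x) + (\<Sum>t\<in>T. real (card (sift W (x div t))))"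
    by (simp flip: of_nat_sum of_nat_add del: of_nat_sum of_nat_add)
  have "real (card (sift (W \<union> L) x)) \<le> 2 * real (card (sift (W \<union> L \<union> T) x))"
    using 1 2 lo sum_up[of L] sum_up[of T] ineq by (simp add: algebra_simps)
  thus ?thesis by linarith
qed


section \<open>Comparison with the first primes\<close>

lemma nth_sorted_list_of_set_mem:
  assumes "finite T" "i < card T"
  shows "sorted_list_of_set T ! i \<in> T"
  using assms by (metis length_sorted_list_of_set nth_mem set_sorted_list_of_set)

text \<open>Every element of \<open>T\<close> is an entry of \<open>xs\<close> or lies beyond all of
  them. An increasing enumeration of \<open>T\<close> can therefore skip entries of
  \<open>xs\<close> but never fall behind.\<close>

lemma nth_le_sorted_list_of_set:
  fixes T :: "nat set"
  assumes "finite T" "sorted_wrt (<) xs" "\<And>t. t \<in> T \<Longrightarrow> t \<in> set xs \<or> (\<forall>x\<in>set xs. x < t)"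
    and "i < card T" "i < length xs"
  shows "xs ! i \<le> sorted_list_of_set T ! i"
  using assms(4,5)
proof (induction i)
  case 0
  define t where "t = sorted_list_of_set T ! 0"
  have "t \<in> T" unfolding t_def using 0 assms(1) by (intro nth_sorted_list_of_set_mem)
  from assms(3)[OF this] show ?case
  proof
    assume "t \<in> set xs"
    then obtain k where k: "k < length xs" "xs ! k = t" by (auto simp: in_set_conv_nth)
    thus ?thesis using sorted_nth_mono[OF strict_sorted_imp_sorted[OF assms(2)], of 0 k]
      unfolding t_def by simp
  qed (use 0 in \<open>auto simp: t_def less_imp_le\<close>)
next
  case (Suc i)
  define t where "t = sorted_list_of_set T ! Suc i"
  have "sorted_list_of_set T ! i < t" unfolding t_def using Suc.prems assms(1)
    using strict_sorted_list_of_set[of T] by (simp add: sorted_wrt_iff_nth_less)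
  with Suc have less: "xs ! i < t" by simp
  have "t \<in> T" unfolding t_def using Suc.prems assms(1) by (intro nth_sorted_list_of_set_mem)
  from assms(3)[OF this] show ?case
  proof
    assume "t \<in> set xs"
    then obtain k where k: "k < length xs" "xs ! k = t" by (auto simp: in_set_conv_nth)
    have "i < k" using less k assms(2) Suc.prems
      using sorted_nth_mono[OF strict_sorted_imp_sorted[OF assms(2)], of k i] by (meson Suc_lessD not_less)
    thus ?thesis using sorted_nth_mono[OF strict_sorted_imp_sorted[OF assms(2)], of "Suc i" k] k
      unfolding t_def by simp
  qed (use Suc.prems in \<open>auto simp: t_def less_imp_le\<close>)
qed

lemma sum_le_sum_list_take:
  fixes f :: "nat \<Rightarrow> real"
  assumes "finite T" "sorted_wrt (<) xs" "\<And>t. t \<in> T \<Longrightarrow> t \<in> set xs \<or> (\<forall>x\<in>set xs. x < t)"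
    and "card T \<le> length xs" "\<And>x t. x \<in> set xs \<Longrightarrow> t \<in> T \<Longrightarrow> x \<le> t \<Longrightarrow> f t \<le> f x"
  shows "sum f T \<le> (\<Sum>x\<leftarrow>take (card T) xs. f x)"
proof -
  have "sum f T = (\<Sum>i<card T. f (sorted_list_of_set T ! i))"
    using sum_list_distinct_conv_sum_set[of "sorted_list_of_set T" f] assms(1)
    by (simp add: sum_list_sum_nth atLeast0LessThan)
  also have "\<dots> \<le> (\<Sum>i<card T. f (xs ! i))"
    using assms(1,4) nth_le_sorted_list_of_set[OF assms(1-3)]
    by (intro sum_mono assms(5)) (auto simp: nth_sorted_list_of_set_mem)
  also have "\<dots> = (\<Sum>x\<leftarrow>take (card T) xs. f x)"
    using assms(4) by (simp add: sum_list_sum_nth atLeast0LessThan min_absorb2)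
  finally show ?thesis .
qed

text \<open>The type class covers both uses: real factors \<open>1 - 1 / t\<close>, and integers for
  comparing sizes.\<close>

lemma prod_list_take_le_prod:
  fixes f :: "nat \<Rightarrow> 'a :: linordered_idom"
  assumes "finite T" "sorted_wrt (<) xs" "\<And>t. t \<in> T \<Longrightarrow> t \<in> set xs \<or> (\<forall>x\<in>set xs. x < t)"
    and "card T \<le> length xs" "\<And>x t. x \<in> set xs \<Longrightarrow> t \<in> T \<Longrightarrow> x \<le> t \<Longrightarrow> f x \<le> f t"
    and "\<And>x. x \<in> set xs \<Longrightarrow> 0 \<le> f x"
  shows "(\<Prod>x\<leftarrow>take (card T) xs. f x) \<le> prod f T"
proof -
  have "(\<Prod>x\<leftarrow>take (card T) xs. f x) = (\<Prod>i<card T. f (xs ! i))"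
    using assms(4) by (simp add: prod.list_conv_set_nth atLeast0LessThan min_absorb2)
  also have "\<dots> \<le> (\<Prod>i<card T. f (sorted_list_of_set T ! i))"
    using assms(1,4) nth_le_sorted_list_of_set[OF assms(1-3)]
    by (intro prod_mono conjI assms(5,6)) (auto simp: nth_sorted_list_of_set_mem)
  also have "\<dots> = prod f T"
    using prod.distinct_set_conv_list[of "sorted_list_of_set T" f] assms(1)
    by (simp add: prod.list_conv_set_nth atLeast0LessThan)
  finally show ?thesis .
qed

lemma prod_prime_factors_le:
  assumes "(n::nat) > 0"
  shows "\<Prod>(prime_factors n) \<le> n"
proof -
  have "\<Prod>(prime_factors n) \<le> (\<Prod>p\<in>prime_factors n. p ^ multiplicity p n)"
    by (intro prod_mono) (auto simp: prime_factors_multiplicity intro!: self_le_power prime_gt_0_nat Suc_leI)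
  also have "\<dots> = n" using assms by (simp add: prime_factorization_nat[symmetric])
  finally show ?thesis .
qed

text \<open>Otherwise a subset with exactly \<open>length xs\<close> elements would already have
  product at least \<open>prod_list xs\<close>. For a list of primes this bounds the number of prime
  factors of \<open>N\<close>.\<close>

lemma card_less_if_prod_less:
  fixes T :: "nat set"
  assumes "finite T" "sorted_wrt (<) xs" "\<And>t. t \<in> T \<Longrightarrow> t \<in> set xs \<or> (\<forall>x\<in>set xs. x < t)"
    and "\<Prod>T < prod_list xs" "0 \<notin> T"
  shows "card T < length xs"
proof (rule ccontr)
  assume "\<not> card T < length xs"
  then obtain U where U: "U \<subseteq> T" "card U = length xs"
    by (metis not_less obtain_subset_with_card_n)
  hence "finite U" using assms(1) finite_subset by blast
  have "int (prod_list xs) = (\<Prod>x\<leftarrow>xs. int x)"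
    by (induction xs) auto
  also have "\<dots> = (\<Prod>x\<leftarrow>take (card U) xs. int x)"
    using U by simp
  also have "\<dots> \<le> (\<Prod>u\<in>U. int u)"
    by (rule prod_list_take_le_prod[OF \<open>finite U\<close> assms(2)]) (use U assms in auto)
  also have "\<dots> \<le> (\<Prod>u\<in>T. int u)"
    by (rule prod_mono2) (use U assms in \<open>auto simp: Suc_le_eq intro!: Nat.gr0I\<close>)
  finally show False using assms(4) by (simp flip: of_nat_prod)
qed

section \<open>Small primes\<close>

definition primes_below :: "nat \<Rightarrow> nat set" where
  "primes_below p = {l. prime l \<and> l < p}"

definition primes_480 :: "nat list" where
  "primes_480 = [2, 3, 5, 7, 11, 13, 17, 19,
    23, 29, 31, 37, 41, 43, 47, 53, 59, 61, 67, 71, 73, 79, 83, 89, 97, 101, 103, 107, 109,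
    113, 127, 131, 137, 139, 149, 151, 157, 163, 167, 173, 179, 181, 191, 193, 197, 199,
    211, 223, 227, 229, 233, 239, 241, 251, 257, 263, 269, 271, 277, 281, 283, 293, 307,
    311, 313, 317, 331, 337, 347, 349, 353, 359, 367, 373, 379, 383, 389, 397, 401, 409,
    419, 421, 431, 433, 439, 443, 449, 457, 461, 463, 467, 479]"

text \<open>Trial division up to 19 suffices because 480 < 23 * 23. From this form it is immediate
  that every prime below 480 is listed and that the list is increasing.\<close>

lemma primes_480_eq_filter:
  "primes_480 = filter (\<lambda>l. \<forall>d\<in>set [2, 3, 5, 7, 11, 13, 17, 19]. d dvd l \<longrightarrow> d = l) [2..<480]"
  unfolding primes_480_def by code_simp

lemma set_primes_480: "set primes_480 \<subseteq> {2..<480}"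
proof -
  have "set primes_480 \<subseteq> set [2..<480]"
    unfolding primes_480_eq_filter by (rule filter_is_subset)
  thus ?thesis by (simp only: set_upt)
qed

lemma prime_less_480:
  assumes "prime l" "l < 480"
  shows "l \<in> set primes_480"
proof -
  have "d = l" if "d \<in> set [2, 3, 5, 7, 11, 13, 17, 19]" "d dvd l" for d
    using assms(1) that by (auto simp: prime_nat_iff)
  thus ?thesis unfolding primes_480_eq_filter set_filter set_upt
    using assms prime_ge_2_nat by (blast intro: atLeastLessThan_iff[THEN iffD2])
qed

text \<open>The densities are 1/2, 2/3, 4/5, 6/7 multiplied up, and the errors are
  \<open>2 ^ card R / 2\<close> for one, two and three odd primes.\<close>

lemma wheel_sieve_bounds:
  assumes "y \<ge> 0"
  shows "\<bar>real (card (sift {2, 3} (nat \<lfloor>y\<rfloor>))) - 1 / 3 * y\<bar> \<le> 1"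
    "\<bar>real (card (sift {2, 3, 5} (nat \<lfloor>y\<rfloor>))) - 4 / 15 * y\<bar> \<le> 2"
    "\<bar>real (card (sift {2, 3, 5, 7} (nat \<lfloor>y\<rfloor>))) - 8 / 35 * y\<bar> \<le> 4"
proof -
  have legendre: "\<bar>real (card (sift (insert 2 R) (nat \<lfloor>y\<rfloor>))) - y / 2 * (\<Prod>l\<in>R. 1 - 1 / real l)\<bar>
           \<le> 2 ^ card R / 2" if "R \<subseteq> {3, 5, 7}" for R
    by (rule legendre_sieve) (use that assms finite_subset in auto)
  show "\<bar>real (card (sift {2, 3} (nat \<lfloor>y\<rfloor>))) - 1 / 3 * y\<bar> \<le> 1"
    using legendre[of "{3}"] by simp
  show "\<bar>real (card (sift {2, 3, 5} (nat \<lfloor>y\<rfloor>))) - 4 / 15 * y\<bar> \<le> 2"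
    using legendre[of "{3, 5}"] by simp
  show "\<bar>real (card (sift {2, 3, 5, 7} (nat \<lfloor>y\<rfloor>))) - 8 / 35 * y\<bar> \<le> 4"
    using legendre[of "{3, 5, 7}"] by simp
qed

lemma sorted_primes_480: "sorted_wrt (<) primes_480"
  unfolding primes_480_eq_filter by (intro sorted_wrt_filter sorted_wrt_upt)

text \<open>This provides the hypothesis of the comparison lemmas for the first \<open>n\<close>
  listed primes above \<open>a\<close>; primes from 480 on exceed the whole list.\<close>

lemma next_primes_cover:
  assumes "prime t" "a < t" "xs = take n (filter ((<) a) primes_480)"
  shows "t \<in> set xs \<or> (\<forall>x\<in>set xs. x < t)"
proof (cases "t < 480")
  case True
  define ys where "ys = filter ((<) a) primes_480"
  have xs: "xs = take n ys" by (simp only: assms(3) ys_def)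
  have ys: "sorted_wrt (<) ys" unfolding ys_def by (intro sorted_wrt_filter sorted_primes_480)
  have "t \<in> set ys" using prime_less_480[OF assms(1) True] assms(2) by (simp add: ys_def)
  hence "t \<in> set xs \<or> t \<in> set (drop n ys)"
    using set_append[of "take n ys" "drop n ys"] unfolding xs by simp
  moreover have "\<forall>x\<in>set (take n ys). \<forall>y\<in>set (drop n ys). x < y"
    using ys sorted_wrt_append[of "(<)" "take n ys" "drop n ys"] by simp
  ultimately show ?thesis unfolding xs by blast
next
  case False
  have "x < t" if "x \<in> set xs" for x
  proof -
    have "x \<in> set primes_480" using that assms(3) by (auto dest: in_set_takeD)
    with set_primes_480 False show ?thesis by auto
  qed
  thus ?thesis by blast
qed

text \<open>
  The primes below \<open>w\<close> are sieved exactly, those in \<open>{w..<p}\<close> by the union bound. The bounds are uniform for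
  \<open>a \<le> p \<le> b\<close>: \<open>s\<close> dominates the reciprocals of the primes in \<open>{w..<p}\<close>, \<open>u\<close> the reciprocals of the prime
  factors of \<open>N\<close> if there are \<open>r\<close> of them, and \<open>X\<close> is a lower bound for \<open>x\<close>.
\<close>

lemma coprime_majority_range:
  fixes c e s :: real and ls xs :: "nat list" and p N x a b w k t :: nat
  assumes W: "\<And>y. y \<ge> 0 \<Longrightarrow> \<bar>real (card (sift (primes_below w) (nat \<lfloor>y\<rfloor>))) - c * y\<bar> \<le> e"
    and ce: "c \<ge> 0" "e \<ge> 0"
    and ls: "ls = filter (\<lambda>l. w \<le> l \<and> l < b) primes_480" "(\<Sum>l\<leftarrow>ls. 1 / real l) \<le> s"
    and xs: "xs = take k (filter ((<) a) primes_480)" "xs \<noteq> []" "N < prod_list xs"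
    and num: "\<forall>r\<in>set [1..<length xs].
       let u = (\<Sum>q\<leftarrow>take r xs. 1 / real q); X = max (a * hd xs) (prod_list (take r xs) / b - 1)
       in s + 2 * u \<le> 1 \<and> e * (1 + length ls + 2 * r) \<le> c * X * (1 - s - 2 * u)"
    and p: "prime p" "a \<le> p" "p \<le> b" "w \<le> a" "b < 480"
    and T: "\<And>t. t \<in> prime_factors N \<Longrightarrow> p < t"
    and N: "x = (N - 1) div p" "0 < N" "t \<in> prime_factors N" "p * t \<le> x"
  shows "card (sift (primes_below p) x) \<le> 2 * card (sift (primes_below p \<union> prime_factors N) x)"
proof -
  define T where "T = prime_factors N"
  define L where "L = primes_below p - primes_below w"
  have T': "finite T" "\<And>t. t \<in> T \<Longrightarrow> prime t" by (auto simp: T_def)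
  have cover: "t \<in> set xs \<or> (\<forall>x\<in>set xs. x < t)" if "t \<in> T" for t
    using T[of t] that p(2) by (intro next_primes_cover[OF _ _ xs(1)]) (auto simp: T_def)
  have xs_sorted: "sorted_wrt (<) xs"
    unfolding xs(1) by (intro sorted_wrt_take sorted_wrt_filter sorted_primes_480)
  have xs_pos: "0 \<notin> set xs" unfolding xs(1) by (auto dest: in_set_takeD)
  have "\<Prod>T \<le> N" using prod_prime_factors_le N(2) by (simp add: T_def)
  define r where "r = card T"
  \<comment> \<open>By \<open>N < prod_list xs\<close> there are fewer than \<open>length xs\<close>
    prime factors, so the finite check \<open>num\<close> covers every possible
    \<open>r\<close>.\<close>
  have r: "r < length xs" unfolding r_def
    by (rule card_less_if_prod_less[OF T'(1) xs_sorted cover])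
       (use \<open>\<Prod>T \<le> N\<close> xs(3) in \<open>auto simp: T_def\<close>)
  moreover have "1 \<le> r" using N(3) T'(1) by (auto simp: r_def Suc_le_eq card_gt_0_iff T_def)
  ultimately have r': "r \<in> set [1..<length xs]" by simp
  define u where "u = (\<Sum>q\<leftarrow>take r xs. 1 / real q)"
  define X where "X = max (a * hd xs) (prod_list (take r xs) / b - 1)"
  have num': "s + 2 * u \<le> 1" "e * (1 + length ls + 2 * r) \<le> c * X * (1 - s - 2 * u)"
    using num[rule_format, OF r'] by (simp_all add: Let_def u_def X_def)
  have sumT: "(\<Sum>t\<in>T. 1 / real t) \<le> u"
    unfolding u_def r_def
    by (rule sum_le_sum_list_take[OF T'(1) xs_sorted cover])
       (use r xs_pos in \<open>auto simp: r_def frac_le intro!: frac_le Nat.gr0I\<close>)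
  have "L \<subseteq> set ls"
    unfolding ls(1) L_def primes_below_def using p(3,5) by (auto intro: prime_less_480)
  have "distinct ls" using sorted_primes_480 by (simp add: ls(1) strict_sorted_iff)
  have "(\<Sum>l\<in>L. 1 / real l) \<le> (\<Sum>l\<in>set ls. 1 / real l)"
    by (rule sum_mono2) (use \<open>L \<subseteq> set ls\<close> in auto)
  hence sumL: "(\<Sum>l\<in>L. 1 / real l) \<le> s"
    using ls(2) \<open>distinct ls\<close> by (simp add: sum_list_distinct_conv_sum_set)
  have "finite L" using \<open>L \<subseteq> set ls\<close> finite_subset by blast
  have cardL: "card L \<le> length ls"
    using card_mono[OF _ \<open>L \<subseteq> set ls\<close>] card_length[of ls] by simp
  have "p > 0" using p(1) prime_gt_0_nat by blast
  \<comment> \<open>First lower bound for \<open>x\<close>: no prime factor of \<open>N\<close> is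
    smaller than \<open>hd xs\<close>.\<close>
  have "hd xs \<le> t"
    using cover[of t] N(3) xs_sorted xs(2) by (cases xs) (auto simp: T_def)
  hence "a * hd xs \<le> p * t" using p(2) by (intro mult_mono) auto
  hence X1: "real (a * hd xs) \<le> x" using N(4) by (simp only: of_nat_le_iff)
  \<comment> \<open>Second lower bound for \<open>x\<close>: \<open>N\<close> is at least the
    product of the first \<open>r\<close> entries and at most \<open>b * (x + 1)\<close>.\<close>
  have "int (prod_list (take r xs)) = (\<Prod>x\<leftarrow>take r xs. int x)" for r
    by (induction xs arbitrary: r) (auto simp: take_Cons split: nat.splits)
  hence "int (prod_list (take r xs)) \<le> (\<Prod>t\<in>T. int t)"
    unfolding r_def using prod_list_take_le_prod[OF T'(1) xs_sorted cover, of int] r by (simp add: r_def)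
  also have "\<dots> \<le> int N" using \<open>\<Prod>T \<le> N\<close> by (simp flip: of_nat_prod)
  finally have "prod_list (take r xs) \<le> N" by simp
  also have "N \<le> p * (x + 1)"
    using dividend_less_div_times[OF \<open>p > 0\<close>, of "N - 1"] N(1,2) by (simp add: algebra_simps)
  also have "p * (x + 1) \<le> b * (x + 1)" using p(3) by (intro mult_mono) auto
  finally have "real (prod_list (take r xs)) \<le> real (b * (x + 1))" by (simp only: of_nat_le_iff)
  moreover have "b > 0" using \<open>p > 0\<close> p by simp
  ultimately have X2: "prod_list (take r xs) / b - 1 \<le> x" by (simp add: field_simps)
  have Wp: "primes_below w \<union> L = primes_below p" using p(2,4) by (auto simp: L_def primes_below_def)
  have "card (sift (primes_below w \<union> L) x) \<le> 2 * card (sift (primes_below w \<union> L \<union> T) x)"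
  proof (rule sieve_majority[OF W \<open>finite L\<close> T'(1)])
    fix q assume "q \<in> primes_below w \<union> L \<union> T"
    thus "prime q" using T'(2) by (auto simp: L_def primes_below_def)
  next
    have "e * (1 + card L + 2 * card T) \<le> e * (1 + length ls + 2 * r)"
      using cardL ce(2) by (intro mult_left_mono) (auto simp: r_def)
    also have "\<dots> \<le> c * X * (1 - s - 2 * u)" by (rule num')
    \<comment> \<open>The first part of \<open>num'\<close> makes \<open>1 - s - 2 * u\<close>
      nonnegative, so \<open>X\<close> may be replaced by the larger \<open>x\<close>.\<close>
    also have "\<dots> \<le> c * x * (1 - s - 2 * u)"
      using num'(1) X1 X2 ce(1) by (intro mult_right_mono mult_left_mono) (auto simp: X_def)
    also have "\<dots> \<le> c * x * (1 - (\<Sum>l\<in>L. 1 / l) - 2 * (\<Sum>t\<in>T. 1 / t))"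
      using sumT sumL ce(1) by (intro mult_left_mono) auto
    finally show "e * (1 + card L + 2 * card T) \<le> c * x * (1 - (\<Sum>l\<in>L. 1 / l) - 2 * (\<Sum>t\<in>T. 1 / t))" .
  next
    show "primes_below w \<inter> L = {}" by (auto simp: L_def)
    have "q < p" if "q \<in> primes_below w \<union> L" for q using that Wp by (auto simp: primes_below_def)
    thus "(primes_below w \<union> L) \<inter> T = {}" using T by (metis T_def disjoint_iff less_asym)
  qed
  thus ?thesis unfolding Wp T_def .
qed

lemma primes_below_code: "primes_below w = set (filter prime [0..<w])"
  by (auto simp: primes_below_def)

lemma primes_below_small:
  "primes_below 2 = {}" "primes_below 3 = {2}"
  "primes_below 5 = {2, 3}" "primes_below 7 = {2, 3, 5}" "primes_below 11 = {2, 3, 5, 7}"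
proof -
  have "filter prime [0..<2::nat] = []" "filter prime [0..<3::nat] = [2]" "filter prime [0..<5::nat] = [2, 3]"
    "filter prime [0..<7::nat] = [2, 3, 5]" "filter prime [0..<11::nat] = [2, 3, 5, 7]"
    by code_simp+
  thus "primes_below 2 = {}" "primes_below 3 = {2}"
    "primes_below 5 = {2, 3}" "primes_below 7 = {2, 3, 5}" "primes_below 11 = {2, 3, 5, 7}"
    by (simp_all only: primes_below_code list.set)
qed

text \<open>
  Each range is as long as the numerical condition permits, and \<open>k\<close> is the least number of primes following
  \<open>a\<close> whose product reaches \<open>n0\<close>.
\<close>

lemma coprime_majority_less_480:
  fixes p N x t :: nat
  assumes p: "prime p" "5 \<le> p" "p < 480" "N < n0"
    and T: "\<And>t. t \<in> prime_factors N \<Longrightarrow> p < t"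
    and N: "x = (N - 1) div p" "0 < N" "t \<in> prime_factors N" "p * t \<le> x"
  shows "card (sift (primes_below p) x) \<le> 2 * card (sift (primes_below p \<union> prime_factors N) x)"
proof -
  have N0: "N < 111546435" using p(4) by (simp add: n0_def)
  have wheel5: "\<bar>real (card (sift (primes_below 5) (nat \<lfloor>y\<rfloor>))) - 1 / 3 * y\<bar> \<le> 1" if "0 \<le> y" for y
    using wheel_sieve_bounds(1)[OF that] by (simp add: primes_below_small)
  have wheel7: "\<bar>real (card (sift (primes_below 7) (nat \<lfloor>y\<rfloor>))) - 4 / 15 * y\<bar> \<le> 2" if "0 \<le> y" for y
    using wheel_sieve_bounds(2)[OF that] by (simp add: primes_below_small)
  have wheel11: "\<bar>real (card (sift (primes_below 11) (nat \<lfloor>y\<rfloor>))) - 8 / 35 * y\<bar> \<le> 4" if "0 \<le> y" for y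
    using wheel_sieve_bounds(3)[OF that] by (simp add: primes_below_small)
  have "p \<in> set primes_480" using p prime_less_480 by simp
  \<comment> \<open>One range ends and the next begins at consecutive primes.\<close>
  then consider "p = 5" | "p = 7" | "p = 11" | "13 \<le> p" "p \<le> 17" | "19 \<le> p" "p \<le> 31"
    | "37 \<le> p" "p \<le> 79" | "83 \<le> p" "p \<le> 251" | "257 \<le> p" "p \<le> 479"
    using p(2) unfolding primes_480_def by auto
  thus ?thesis
  proof cases
    case 1
    \<comment> \<open>For 5, 7 and 11 all smaller primes are sieved exactly, so \<open>ls\<close> is
      empty and \<open>s = 0\<close>.\<close>
    show ?thesis
      by (rule coprime_majority_range[OF wheel5 _ _ refl _ refl, where k = 7 and a = 5 and b = 5 and s = 0 and N = N])
         (use 1 assms N0 in \<open>simp_all add: primes_480_def\<close>)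
  next
    case 2
    show ?thesis
      by (rule coprime_majority_range[OF wheel7 _ _ refl _ refl, where k = 7 and a = 7 and b = 7 and s = 0 and N = N])
         (use 2 assms N0 in \<open>simp_all add: primes_480_def\<close>)
  next
    case 3
    show ?thesis
      by (rule coprime_majority_range[OF wheel11 _ _ refl _ refl, where k = 7 and a = 11 and b = 11 and s = 0 and N = N])
         (use 3 assms N0 in \<open>simp_all add: primes_480_def\<close>)
  next
    case 4
    \<comment> \<open>From here on \<open>s\<close> is the sum of the reciprocals of the primes from
      11 to below \<open>b\<close>, rounded up.\<close>
    show ?thesis
      by (rule coprime_majority_range[OF wheel11 _ _ refl _ refl, where k = 6 and a = 13 and b = 17 and s = "17 / 100" and N = N])
         (use 4 assms N0 in \<open>simp_all add: primes_480_def\<close>)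
  next
    case 5
    show ?thesis
      by (rule coprime_majority_range[OF wheel11 _ _ refl _ refl, where k = 6 and a = 19 and b = 31 and s = "358 / 1000" and N = N])
         (use 5 assms N0 in \<open>simp_all add: primes_480_def\<close>)
  next
    case 6
    show ?thesis
      by (rule coprime_majority_range[OF wheel11 _ _ refl _ refl, where k = 5 and a = 37 and b = 79 and s = "581 / 1000" and N = N])
         (use 6 assms N0 in \<open>simp_all add: primes_480_def\<close>)
  next
    case 7
    show ?thesis
      by (rule coprime_majority_range[OF wheel11 _ _ refl _ refl, where k = 5 and a = 83 and b = 251 and s = "8035 / 10000" and N = N])
         (use 7 assms N0 in \<open>simp_all add: primes_480_def\<close>)
  next
    case 8
    show ?thesis
      by (rule coprime_majority_range[OF wheel11 _ _ refl _ refl, where k = 4 and a = 257 and b = 479 and s = "913 / 1000" and N = N])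
         (use 8 assms N0 in \<open>simp_all add: primes_480_def\<close>)
  qed
qed

section \<open>Enemies against friends in one class\<close>

lemma square_least_prime_factor_le:
  fixes N :: nat
  assumes "N > 1" "\<not> prime N" "\<And>t. t \<in> prime_factors N \<Longrightarrow> p < t"
  shows "p * p < N"
proof -
  obtain q where q: "prime q" "q dvd N" using assms(1) prime_factor_nat by (metis less_irrefl)
  then obtain m where m: "N = q * m" by auto
  have "m \<noteq> 1" "m > 0" using m q assms by auto
  then obtain r where r: "prime r" "r dvd m" using prime_factor_nat by blast
  hence "r dvd N" using m by simp
  have "p < q" "p < r" using assms(1,3) q r \<open>r dvd N\<close> by (auto simp: in_prime_factors_iff)
  moreover have "r \<le> m" using r \<open>m > 0\<close> by (auto dest: dvd_imp_le)
  ultimately show ?thesis unfolding m by (intro mult_strict_mono') auto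
qed

lemma coprime_majority_few_multiples:
  fixes N :: nat
  assumes N: "N > 1" "\<not> prime N" and p: "prime p"
    and T: "\<And>t. t \<in> prime_factors N \<Longrightarrow> p < t"
    and x: "x = (N - 1) div p" "\<And>t. t \<in> prime_factors N \<Longrightarrow> x < p * t"
  shows "card (sift (primes_below p) x) \<le> 2 * card (sift (primes_below p \<union> prime_factors N) x)"
proof -
  define T where "T = prime_factors N"
  have "p > 1" using p prime_gt_1_nat by blast
  \<comment> \<open>Hence \<open>p\<close> itself is among the quotients; it will be the second
    enemy besides 1.\<close>
  have "p * p \<le> N - 1" using square_least_prime_factor_le[OF N T] by simp
  hence "p \<le> x" using \<open>p > 1\<close> by (simp add: x(1) less_eq_div_iff_mult_less_eq)
  have "sift (primes_below p) x \<subseteq> sift (primes_below p \<union> T) x \<union> T"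
  proof
    fix k assume k: "k \<in> sift (primes_below p) x"
    show "k \<in> sift (primes_below p \<union> T) x \<union> T"
    proof (cases "\<exists>t\<in>T. t dvd k")
      case True
      then obtain t m where t: "t \<in> T" "k = t * m" by blast
      have "t * m \<le> x" using k t by (simp add: sift_def)
      also have "x < t * p" using x(2)[of t] t(1) by (simp only: T_def mult.commute[of t p])
      finally have "m < p" by simp
      \<comment> \<open>The cofactor is below \<open>p\<close> but has no prime factor below
        \<open>p\<close>.\<close>
      have "m = 1"
      proof (rule ccontr)
        assume "m \<noteq> 1"
        then obtain l where l: "prime l" "l dvd m" using prime_factor_nat by blast
        moreover have "m > 0" using k t by (auto simp: sift_def intro!: Nat.gr0I)
        ultimately have "l < p" using \<open>m < p\<close> dvd_imp_le le_less_trans by blast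
        with l k t show False by (auto simp: sift_def primes_below_def)
      qed
      with t show ?thesis by simp
    qed (use k in \<open>auto simp: sift_def\<close>)
  qed
  hence "card (sift (primes_below p) x) \<le> card (sift (primes_below p \<union> T) x \<union> T)"
    by (intro card_mono) (auto simp: T_def)
  also have "\<dots> \<le> card (sift (primes_below p \<union> T) x) + card T" by (rule card_Un_le)
  finally have 1: "card (sift (primes_below p) x) \<le> card (sift (primes_below p \<union> T) x) + card T" .
  have "\<not> l dvd p" if "l \<in> primes_below p \<union> T" for l
  proof
    assume "l dvd p"
    with \<open>p > 1\<close> have "l \<le> p" by (intro dvd_imp_le) auto
    with that T have "l \<in> primes_below p" by (auto simp: T_def dest: leD)
    with \<open>l dvd p\<close> p show False using primes_dvd_imp_eq by (auto simp: primes_below_def)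
  qed
  moreover have "l \<noteq> 1" if "l \<in> primes_below p \<union> T" for l
    using that not_prime_1 by (auto simp: primes_below_def T_def dest: in_prime_factors_imp_prime)
  ultimately have "{1, p} \<subseteq> sift (primes_below p \<union> T) x"
    using \<open>p > 1\<close> \<open>p \<le> x\<close> by (auto simp: sift_def)
  hence "card {1, p} \<le> card (sift (primes_below p \<union> T) x)" by (intro card_mono) auto
  hence 2: "2 \<le> card (sift (primes_below p \<union> T) x)" using \<open>p > 1\<close> by simp
  \<comment> \<open>Three prime factors \<open>a\<close>, \<open>b\<close>, \<open>c\<close> would
    give \<open>N\<close> <= \<open>p * (x + 1)\<close> <= \<open>p * (p * c)\<close> <
    \<open>a * b * c\<close> <= \<open>N\<close>.\<close>
  have "card T \<le> 2"
  proof (rule ccontr)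
    assume "\<not> card T \<le> 2"
    hence "3 \<le> card T" by simp
    then obtain U where U: "U \<subseteq> T" "card U = 3" by (metis obtain_subset_with_card_n)
    then obtain a b c where abc: "U = {a, b, c}" "a \<noteq> b" "a \<noteq> c" "b \<noteq> c" by (auto simp: card_3_iff)
    hence less: "p < a" "p < b" "x < p * c" using U(1) T x(2) by (auto simp: T_def)
    have "\<Prod>U dvd \<Prod>T" by (rule prod_dvd_prod_subset) (use U in \<open>auto simp: T_def\<close>)
    moreover have "\<Prod>T > 0" by (auto simp: T_def intro!: prod_pos prime_gt_0_nat)
    ultimately have "\<Prod>U \<le> \<Prod>T" by (rule dvd_imp_le)
    also have "\<dots> \<le> N" using prod_prime_factors_le N(1) by (simp add: T_def)
    finally have "a * b * c \<le> N" using abc by (simp add: mult.assoc)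
    have "N \<le> p * (x + 1)"
      using dividend_less_div_times[of p "N - 1"] \<open>p > 1\<close> N(1) by (simp add: x(1) algebra_simps)
    also have "\<dots> \<le> p * (p * c)" using less by (intro mult_left_mono) auto
    also have "\<dots> < a * b * c"
    proof -
      have "c > 0" using less(3) by (cases c) auto
      thus ?thesis using less(1,2) by (simp add: mult.assoc[symmetric] mult_strict_mono')
    qed
    finally show False using \<open>a * b * c \<le> N\<close> by simp
  qed
  with 1 2 show ?thesis by (simp add: T_def)
qed

lemma coprime_majority_ge_5:
  fixes N :: nat
  assumes N: "N > 1" "\<not> prime N" "N < n0" and p: "prime p" "p \<ge> 5"
    and T: "\<And>t. t \<in> prime_factors N \<Longrightarrow> p < t"
    and x: "x = (N - 1) div p"
  shows "card (sift (primes_below p) x) \<le> 2 * card (sift (primes_below p \<union> prime_factors N) x)"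
proof (cases "\<exists>t\<in>prime_factors N. p * t \<le> x")
  case True
  then obtain t where t: "t \<in> prime_factors N" "p * t \<le> x" by blast
  have "p * (p * t) \<le> p * x" using t by simp
  also have "\<dots> \<le> N - 1" by (simp add: x)
  finally have le: "p * (p * t) < 111546435" using N(3) by (simp add: n0_def)
  \<comment> \<open>By \<open>p < t\<close>, the cube of \<open>p\<close> is below
    \<open>n0\<close>, whereas the cube of 482 exceeds it; 480 and 481 = 13 * 37 are not
    prime.\<close>
  have "p < 480"
  proof (rule ccontr)
    assume "\<not> p < 480"
    moreover have "p \<noteq> 480" "p \<noteq> 481" using p(1)
      using primes_dvd_imp_eq[of 2 p] primes_dvd_imp_eq[of 13 p] p(1) by auto
    ultimately have "482 \<le> p" by simp
    hence "482 * (482 * 482) \<le> p * (p * t)" using T[OF t(1)] by (intro mult_mono) auto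
    with le show False by simp
  qed
  with t show ?thesis using coprime_majority_less_480[OF p _ N(3) T x] N(1) by auto
next
  case False
  thus ?thesis using coprime_majority_few_multiples[OF N(1,2) p(1) T x] by (auto simp: not_le)
qed

section \<open>The primes 2 and 3\<close>

lemma prod_one_minus_inverse_ge:
  assumes "finite T" "sorted_wrt (<) xs" "\<And>t. t \<in> T \<Longrightarrow> t \<in> set xs \<or> (\<forall>x\<in>set xs. x < t)"
    and "card T \<le> length xs" "0 \<notin> set xs"
  shows "(\<Prod>t\<leftarrow>take (card T) xs. 1 - 1 / real t) \<le> (\<Prod>t\<in>T. 1 - 1 / real t)"
proof (rule prod_list_take_le_prod[OF assms(1-4)])
  fix x assume "x \<in> set xs"
  hence "x > 0" using assms(5) by (intro Nat.gr0I) auto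
  thus "0 \<le> 1 - 1 / real x" by simp
  fix t assume "x \<le> t"
  with \<open>x > 0\<close> show "1 - 1 / real x \<le> 1 - 1 / real t" by (simp add: frac_le)
qed

lemma prod_list_take_le_number:
  fixes N :: nat
  assumes "0 < N" "sorted_wrt (<) xs" "\<And>t. t \<in> prime_factors N \<Longrightarrow> t \<in> set xs \<or> (\<forall>x\<in>set xs. x < t)"
    and "card (prime_factors N) \<le> length xs"
  shows "prod_list (take (card (prime_factors N)) xs) \<le> N"
proof -
  have "int (prod_list (take r xs)) = (\<Prod>x\<leftarrow>take r xs. int x)" for r
    by (induction xs arbitrary: r) (auto simp: take_Cons split: nat.splits)
  hence "int (prod_list (take (card (prime_factors N)) xs)) \<le> (\<Prod>t\<in>prime_factors N. int t)"
    using prod_list_take_le_prod[OF _ assms(2-4), of int] by simp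
  also have "\<dots> \<le> int N" using prod_prime_factors_le[OF assms(1)] by (simp flip: of_nat_prod)
  finally show ?thesis by simp
qed

lemma prime_le_29_cases:
  fixes t :: nat
  assumes "prime t"
  shows "t \<in> set [2, 3, 5, 7, 11, 13, 17, 19, 23, 29] \<or> 29 < t"
proof (cases "t < 30")
  case True
  have "t \<in> set primes_480" using assms True by (intro prime_less_480) auto
  thus ?thesis using True by (auto simp: primes_480_def)
qed auto

lemma coprime_iff_no_prime_factor:
  fixes N :: nat
  assumes "N > 0"
  shows "coprime k N \<longleftrightarrow> (\<forall>l\<in>prime_factors N. \<not> l dvd k)"
proof
  assume "coprime k N"
  thus "\<forall>l\<in>prime_factors N. \<not> l dvd k"
    by (metis coprime_common_divisor_nat in_prime_factors_iff not_prime_1)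
next
  assume *: "\<forall>l\<in>prime_factors N. \<not> l dvd k"
  show "coprime k N"
  proof (rule ccontr)
    assume "\<not> coprime k N"
    hence "gcd k N \<noteq> 1" by (simp add: coprime_iff_gcd_eq_1)
    then obtain l where "prime l" "l dvd gcd k N" using prime_factor_nat by blast
    with * assms show False by (auto simp: in_prime_factors_iff)
  qed
qed

text \<open>The reflection \<open>k\<close> to \<open>N - k\<close> preserves coprimality and
  exchanges the two halves of the totatives.\<close>

lemma totient_eq_double_sift:
  assumes "odd N" "N > 1"
  shows "totient N = 2 * card (sift (prime_factors N) ((N - 1) div 2))"
proof -
  define x where "x = (N - 1) div 2"
  have N: "N = 2 * x + 1" using assms by (auto simp: x_def elim!: oddE)
  define A where "A = sift (prime_factors N) x"
  have A: "k \<in> A \<longleftrightarrow> 1 \<le> k \<and> k \<le> x \<and> coprime k N" for k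
    using assms by (auto simp: A_def sift_def coprime_iff_no_prime_factor)
  have cop: "coprime (N - k) N \<longleftrightarrow> coprime k N" if "k \<le> N" for k
  proof -
    have "gcd (N - k) N = gcd k N"
      using that by (metis gcd.commute gcd_diff2_nat gcd_add2 le_add_diff_inverse2)
    thus ?thesis by (simp add: coprime_iff_gcd_eq_1)
  qed
  have "totatives N = A \<union> (\<lambda>k. N - k) ` A"
  proof (intro set_eqI iffI)
    fix k assume k: "k \<in> totatives N"
    hence "0 < k" "k < N" "coprime k N"
      using assms totatives_less by (auto simp: in_totatives_iff)
    show "k \<in> A \<union> (\<lambda>k. N - k) ` A"
    proof (cases "k \<le> x")
      case False
      hence "N - k \<in> A" using \<open>k < N\<close> \<open>coprime k N\<close> cop[of k] N by (auto simp: A)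
      moreover have "k = N - (N - k)" using \<open>k < N\<close> by simp
      ultimately show ?thesis by blast
    qed (use \<open>0 < k\<close> \<open>coprime k N\<close> A in auto)
  next
    fix k assume "k \<in> A \<union> (\<lambda>k. N - k) ` A"
    thus "k \<in> totatives N" using N cop by (auto simp: A in_totatives_iff)
  qed
  moreover have "card (A \<union> (\<lambda>k. N - k) ` A) = card A + card ((\<lambda>k. N - k) ` A)"
    by (rule card_Un_disjoint) (use N in \<open>auto simp: A_def sift_def\<close>)
  moreover have "card ((\<lambda>k. N - k) ` A) = card A"
    by (rule card_image) (use N in \<open>auto simp: inj_on_def A\<close>)
  ultimately show ?thesis by (simp add: totient_def A_def x_def)
qed

lemma sift_empty: "sift {} x = {1..x}"
  by (auto simp: sift_def)

text \<open>Without 5, seven prime factors would have product at least 7 * 11 * 13 * 17 * 19 * 23 *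
  29 = 215656441, which exceeds \<open>n0\<close>.\<close>

lemma mem_prime_factors_5:
  fixes N :: nat
  assumes "0 < N" "N < n0" "\<And>t. t \<in> prime_factors N \<Longrightarrow> 3 < t" "card (prime_factors N) \<ge> 7"
  shows "5 \<in> prime_factors N"
proof (rule ccontr)
  assume *: "5 \<notin> prime_factors N"
  have "card (prime_factors N) < length [7::nat, 11, 13, 17, 19, 23, 29]"
  proof (rule card_less_if_prod_less)
    fix t assume t: "t \<in> prime_factors N"
    hence "prime t" by (rule in_prime_factors_imp_prime)
    with t * assms(3)[OF t] prime_le_29_cases[of t] show "t \<in> set [7, 11, 13, 17, 19, 23, 29] \<or> (\<forall>x\<in>set [7, 11, 13, 17, 19, 23, 29]. x < t)"
      by auto
  next
    show "\<Prod>(prime_factors N) < prod_list [7, 11, 13, 17, 19, 23, 29]"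
      using prod_prime_factors_le[OF assms(1)] assms(2) by (simp add: n0_def)
  qed auto
  with assms(4) show False by simp
qed

text \<open>The number \<open>n0\<close> is the product of the eight smallest odd primes.\<close>

lemma card_prime_factors_le_7:
  fixes N :: nat
  assumes "odd N" "N < n0"
  shows "card (prime_factors N) \<le> 7"
proof -
  have "0 < N" using assms(1) by (cases N) auto
  have "card (prime_factors N) < length [3::nat, 5, 7, 11, 13, 17, 19, 23]"
  proof (rule card_less_if_prod_less)
    fix t assume t: "t \<in> prime_factors N"
    have "t \<noteq> 2" using assms(1) t by (auto simp: in_prime_factors_iff)
    moreover have "prime t" using t by (rule in_prime_factors_imp_prime)
    ultimately show "t \<in> set [3, 5, 7, 11, 13, 17, 19, 23] \<or> (\<forall>x\<in>set [3, 5, 7, 11, 13, 17, 19, 23]. x < t)"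
      using prime_le_29_cases[of t] by auto
  next
    show "\<Prod>(prime_factors N) < prod_list [3, 5, 7, 11, 13, 17, 19, 23]"
      using prod_prime_factors_le[OF \<open>0 < N\<close>] assms(2) by (simp add: n0_def)
  qed auto
  thus ?thesis by simp
qed

text \<open>A lower bound for the class of 5, used when 5 is the least prime factor: density 1/3
  among about \<open>N / 5\<close> quotients, with the rounding absorbed in 2.\<close>

lemma card_sift_2_3_ge:
  assumes "0 < N" "5 \<in> prime_factors N"
  shows "real N / 15 - 2 \<le> card (sift {2, 3} ((N - 1) div 5))"
proof -
  define y where "y = (N - 1) div 5"
  have "real N \<le> 5 * real y + 5" using assms(1) unfolding y_def by linarith
  moreover have "real y / 3 - 1 \<le> card (sift {2, 3} y)"
    using wheel_sieve_bounds(1)[of "real y"] by (simp add: abs_le_iff)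
  ultimately show ?thesis unfolding y_def[symmetric] by linarith
qed

text \<open>About \<open>x / 2\<close> numbers are odd, and the enemies are a fraction of them given
  by the product of \<open>1 - 1 / t\<close>. Up to six prime factors keep this product above 1/2.
  With seven it can fall below, and the class of 5 has to help.\<close>

lemma coprime_majority_3:
  fixes N :: nat
  assumes N: "N > 1" "\<not> prime N" "N < n0" "odd N"
    and T: "\<And>t. t \<in> prime_factors N \<Longrightarrow> 3 < t"
    and x: "x = (N - 1) div 3"
  shows "card (sift {2} x) \<le> 2 * card (sift ({2} \<union> prime_factors N) x) \<or>
         5 \<in> prime_factors N \<and> card (sift {2} x) < 2 * card (sift ({2} \<union> prime_factors N) x) + card (sift {2, 3} ((N - 1) div 5))"
proof (cases "\<exists>t\<in>prime_factors N. 3 * t \<le> x")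
  case False
  thus ?thesis using coprime_majority_few_multiples[OF N(1,2) _ T x] by (auto simp: not_le primes_below_small)
next
  case True
  define T where "T = prime_factors N"
  define r where "r = card T"
  have fin: "finite T" by (simp add: T_def)
  obtain t where t: "t \<in> T" "3 * t \<le> x" using True by (auto simp: T_def)
  have pr: "prime t" if "t \<in> T" for t using that by (auto simp: T_def)
  have "t \<noteq> 4" using pr[OF t(1)] by auto
  with t T[of t] have "x \<ge> 15" by (auto simp: T_def)
  hence x15: "15 \<le> real x" by simp
  define xs :: "nat list" where "xs = [5, 7, 11, 13, 17, 19, 23]"
  have xs: "sorted_wrt (<) xs" "0 \<notin> set xs" "length xs = 7" by (simp_all add: xs_def)
  have cover: "t \<in> set xs \<or> (\<forall>x\<in>set xs. x < t)" if "t \<in> T" for t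
    using prime_le_29_cases[OF pr[OF that]] T[of t] that by (auto simp: T_def xs_def)
  have "r \<le> 7" using card_prime_factors_le_7[OF N(4,3)] by (simp add: r_def T_def)
  moreover have "r \<ge> 1" using t(1) by (auto simp: r_def Suc_le_eq card_gt_0_iff fin)
  ultimately consider "r = 1" | "r = 2" | "r = 3" | "r = 4" | "r = 5" | "r = 6" | "r = 7" by linarith
  note r_cases = this
  define E where "E = card (sift ({2} \<union> T) x)"
  define \<Pi> where "\<Pi> = (\<Prod>t\<in>T. 1 - 1 / real t)"
  have prod: "(\<Prod>t\<leftarrow>take r xs. 1 - 1 / real t) \<le> \<Pi>" unfolding r_def \<Pi>_def
    by (rule prod_one_minus_inverse_ge[OF fin xs(1) cover]) (use \<open>r \<le> 7\<close> xs in \<open>auto simp: r_def\<close>)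
  have sum: "(\<Sum>t\<in>T. 1 / real t) \<le> (\<Sum>t\<leftarrow>take r xs. 1 / real t)" unfolding r_def
    by (rule sum_le_sum_list_take[OF fin xs(1) cover])
       (use \<open>r \<le> 7\<close> xs in \<open>auto simp: r_def frac_le intro!: frac_le Nat.gr0I\<close>)
  have size: "prod_list (take r xs) \<le> N" unfolding r_def T_def
    by (rule prod_list_take_le_number) (use N(1) xs cover \<open>r \<le> 7\<close> in \<open>auto simp: r_def T_def\<close>)
  have Nx: "N \<le> 3 * x + 3" "3 * x < N" using N(1) by (auto simp: x)
  have two: "2 \<notin> T" using T[of 2] by (auto simp: T_def)
  have "\<bar>real E - real x / 2 * \<Pi>\<bar> \<le> 2 ^ r / 2"
    using legendre_sieve[OF fin pr two, of "real x"] by (simp add: E_def \<Pi>_def r_def)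
  hence E: "real x * \<Pi> - 2 ^ r \<le> 2 * real E" by (simp add: abs_le_iff field_simps)
  have E': "real x * (\<Prod>t\<leftarrow>take r xs. 1 - 1 / real t) - 2 ^ r \<le> 2 * real E"
    using mult_left_mono[OF prod, of "real x"] E by simp
  \<comment> \<open>The union bound serves \<open>r\<close> at most 2, where \<open>x\<close> is
    only known to be at least 15.\<close>
  have "card (sift {2} x) \<le> E + (\<Sum>t\<in>T. card (sift {2} (x div t)))"
    unfolding E_def by (rule card_sift_union_bound) (use fin pr two two_is_prime_nat in auto)
  hence "real (card (sift {2} x)) \<le> real E + (\<Sum>t\<in>T. real (card (sift {2} (x div t))))"
    by (metis of_nat_add of_nat_le_iff of_nat_sum)
  also have "(\<Sum>t\<in>T. real (card (sift {2} (x div t)))) \<le> (\<Sum>t\<in>T. (x * (1 / real t) + 1) / 2)"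
  proof (rule sum_mono)
    fix t
    have "real (card (sift {2} (x div t))) \<le> (real (x div t) + 1) / 2"
      by (rule card_odd_upto_bounds)
    also have "real (x div t) \<le> x * (1 / real t)" using of_nat_div_le_of_nat[of x t, where 'a = real] by simp
    finally show "real (card (sift {2} (x div t))) \<le> (x * (1 / real t) + 1) / 2" by simp
  qed
  also have "\<dots> = (x * (\<Sum>t\<in>T. 1 / real t) + r) / 2"
    by (simp add: sum.distrib sum_distrib_left r_def flip: sum_divide_distrib)
  finally have "real (card (sift {2} x)) \<le> E + (x * (\<Sum>t\<in>T. 1 / real t) + r) / 2" by simp
  hence U: "real (card (sift {2} x)) \<le> E + (x * (\<Sum>t\<leftarrow>take r xs. 1 / real t) + r) / 2"
    by (rule order_trans) (intro add_left_mono divide_right_mono add_right_mono mult_left_mono sum, simp_all)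
  have lo: "real x / 2 \<le> card (sift {2} x)" and up: "card (sift {2} x) \<le> (real x + 1) / 2"
    by (rule card_odd_upto_bounds)+
  show ?thesis
  proof (cases "r = 7")
    case False
    \<comment> \<open>The fractions below are \<open>1 / 5\<close>, \<open>1 / 5 + 1 / 7\<close>, and for \<open>r \<ge> 3\<close> the products of \<open>1 - 1 / t\<close> over the
        first \<open>r\<close> primes \<open>t \<ge> 5\<close>.\<close>
    from r_cases have "real (card (sift {2} x)) \<le> 2 * real E"
    proof cases
      case 1
      hence "real (card (sift {2} x)) \<le> E + (real x * (1 / 5) + 1) / 2"
        using U by (simp add: xs_def)
      thus ?thesis using lo x15 by argo
    next
      case 2
      hence "real (card (sift {2} x)) \<le> E + (real x * (12 / 35) + 2) / 2"
        using U by (simp add: xs_def)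
      thus ?thesis using lo x15 by argo
    next
      case 3
      \<comment> \<open>The bound 127 comes from 5 * 7 * 11 = 385 <= \<open>N\<close> <=
        \<open>3 * x + 3\<close>; the next cases get theirs in the same way.\<close>
      hence "real x * (48 / 77) - 8 \<le> 2 * real E" "127 \<le> x"
        using E' size Nx by (simp_all add: xs_def)
      thus ?thesis using up by simp
    next
      case 4
      hence "real x * (576 / 1001) - 16 \<le> 2 * real E" "1667 \<le> x"
        using E' size Nx by (simp_all add: xs_def)
      thus ?thesis using up by simp
    next
      case 5
      hence "real x * (9216 / 17017) - 32 \<le> 2 * real E" "28360 \<le> x"
        using E' size Nx by (simp_all add: xs_def)
      thus ?thesis using up by simp
    next
      case 6
      hence "real x * (165888 / 323323) - 64 \<le> 2 * real E" "538870 \<le> x"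
        using E' size Nx by (simp_all add: xs_def)
      thus ?thesis using up by simp
    qed (use False in simp)
    thus ?thesis by (simp add: E_def T_def)
  next
    case True
    \<comment> \<open>The product over 5 to 23 is about 0.491, so roughly \<open>x / 100\<close> is
      missing; the class of 5, with about \<open>N / 15\<close> elements, makes up for it.\<close>
    have "5 \<in> T" using mem_prime_factors_5[OF _ N(3) T] N(1) True by (auto simp: r_def T_def)
    moreover have "real N / 15 - 2 \<le> card (sift {2, 3} ((N - 1) div 5))"
      using card_sift_2_3_ge N(1) \<open>5 \<in> T\<close> by (simp add: T_def)
    moreover have "real x * (3649536 / 7436429) - 128 \<le> 2 * real E" "37182145 \<le> N"
      using E' size True by (simp_all add: xs_def)
    moreover have "3 * real x \<le> real N" using Nx by linarith
    ultimately have "real (card (sift {2} x)) < real (2 * E + card (sift {2, 3} ((N - 1) div 5)))"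
      using up by simp
    with \<open>5 \<in> T\<close> show ?thesis by (simp only: of_nat_less_iff E_def T_def simp_thms)
  qed
qed

lemma totient_ge:
  fixes N :: nat
  assumes "0 < N" "sorted_wrt (<) xs" "\<And>t. t \<in> prime_factors N \<Longrightarrow> t \<in> set xs \<or> (\<forall>x\<in>set xs. x < t)"
    and "card (prime_factors N) \<le> length xs" "0 \<notin> set xs"
  shows "real N * (\<Prod>t\<leftarrow>take (card (prime_factors N)) xs. 1 - 1 / real t) \<le> totient N"
  unfolding totient_formula2
  using prod_one_minus_inverse_ge[OF _ assms(2-5)] by (intro mult_left_mono) auto

text \<open>Here \<open>(N - 1) div 2\<close> is the size of the class of 2 and
  \<open>totient N\<close> is twice the number of enemies in it. If 3 divides \<open>N\<close>, the
  claim amounts to \<open>N / 3 < totient N\<close>. Otherwise \<open>totient N\<close> alone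
  exceeds \<open>N / 2\<close>, except possibly for seven prime factors, where the class of 5
  helps.\<close>

lemma coprime_majority_2:
  fixes N :: nat
  assumes N: "N > 1" "N < n0" "odd N"
    and q: "q \<in> prime_factors N" "\<And>t. t \<in> prime_factors N \<Longrightarrow> q \<le> t"
  shows "(N - 1) div 2 < totient N + card (sift (primes_below q) ((N - 1) div q))"
proof -
  define T where "T = prime_factors N"
  define r where "r = card T"
  have fin: "finite T" by (simp add: T_def)
  have pr: "prime t" if "t \<in> T" for t using that by (auto simp: T_def)
  have two: "2 \<notin> T" using N(3) by (auto simp: T_def in_prime_factors_iff)
  have "r \<le> 7" using card_prime_factors_le_7[OF N(3,2)] by (simp add: r_def T_def)
  moreover have "r \<ge> 1" using q(1) by (auto simp: r_def Suc_le_eq card_gt_0_iff fin T_def)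
  ultimately consider "r = 1" | "r = 2" | "r = 3" | "r = 4" | "r = 5" | "r = 6" | "r = 7" by linarith
  note r_cases = this
  show ?thesis
  proof (cases "3 \<in> T")
    case True
    hence "q = 3" using q(2)[of 3] q(1) two prime_ge_2_nat[OF in_prime_factors_imp_prime[OF q(1)]]
      by (cases "q = 2") (auto simp: T_def)
    obtain M where M: "N = 3 * M" using True by (auto simp: T_def in_prime_factors_iff)
    define xs :: "nat list" where "xs = [3, 5, 7, 11, 13, 17, 19]"
    have cover: "t \<in> set xs \<or> (\<forall>x\<in>set xs. x < t)" if "t \<in> T" for t
      using prime_le_29_cases[OF pr[OF that]] two that by (auto simp: xs_def)
    have "real N * (\<Prod>t\<leftarrow>take r xs. 1 - 1 / real t) \<le> totient N" unfolding r_def T_def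
      by (rule totient_ge) (use N \<open>r \<le> 7\<close> cover in \<open>auto simp: r_def T_def xs_def\<close>)
    \<comment> \<open>The product over 3 to 19 is about 0.342; a further factor 22/23 would bring it
      below 1/3.\<close>
    moreover from r_cases have "1 / 3 < (\<Prod>t\<leftarrow>take r xs. 1 - 1 / real t)"
      by cases (simp_all add: xs_def)
    hence "real N * (1 / 3) < real N * (\<Prod>t\<leftarrow>take r xs. 1 - 1 / real t)" using N(1) by simp
    ultimately have "M < totient N" by (simp add: M)
    moreover have "card (sift (primes_below q) ((N - 1) div q)) = M div 2"
      using N(1) by (simp add: \<open>q = 3\<close> primes_below_small card_odd_upto M div_mult2_eq)
    \<comment> \<open>As \<open>M\<close> is odd,
      \<open>(3 * M - 1) div 2 = M + M div 2\<close>.\<close>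
    ultimately show ?thesis using N(1,3) M by (auto elim!: oddE)
  next
    case False
    define xs :: "nat list" where "xs = [5, 7, 11, 13, 17, 19, 23]"
    have cover: "t \<in> set xs \<or> (\<forall>x\<in>set xs. x < t)" if "t \<in> T" for t
      using prime_le_29_cases[OF pr[OF that]] two False that by (auto simp: xs_def)
    have *: "real N * (\<Prod>t\<leftarrow>take r xs. 1 - 1 / real t) \<le> totient N" unfolding r_def T_def
      by (rule totient_ge) (use N \<open>r \<le> 7\<close> cover in \<open>auto simp: r_def T_def xs_def\<close>)
    show ?thesis
    proof (cases "r = 7")
      case r: False
      from r_cases r have "1 / 2 < (\<Prod>t\<leftarrow>take r xs. 1 - 1 / real t)"
        by cases (simp_all add: xs_def)
      hence "real N * (1 / 2) < real N * (\<Prod>t\<leftarrow>take r xs. 1 - 1 / real t)" using N(1) by simp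
      with * show ?thesis by linarith
    next
      case True
      have gt3: "3 < t" if "t \<in> T" for t
        using cover[OF that] by (auto simp: xs_def)
      hence "5 \<in> T" using mem_prime_factors_5[OF _ N(2)] N(1) True by (auto simp: r_def T_def)
      have "prime q" "3 < q" "q \<le> 5" using q gt3 \<open>5 \<in> T\<close> by (auto simp: T_def)
      hence "q = 5" by (cases "q = 4") auto
      have "real N / 15 - 2 \<le> card (sift (primes_below q) ((N - 1) div q))"
        using card_sift_2_3_ge[of N] N(1) \<open>5 \<in> T\<close> by (simp add: T_def \<open>q = 5\<close> primes_below_small)
      moreover have "prod_list (take r xs) \<le> N" unfolding r_def T_def
        by (rule prod_list_take_le_number) (use N(1) cover \<open>r \<le> 7\<close> in \<open>auto simp: r_def T_def xs_def\<close>)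
      moreover have "real ((N - 1) div 2) \<le> real N / 2" by linarith
      ultimately have "real ((N - 1) div 2) < real (totient N + card (sift (primes_below q) ((N - 1) div q)))"
        using * True by (simp add: xs_def)
      thus ?thesis by (simp only: of_nat_less_iff)
    qed
  qed
qed

text \<open>
  Up to the factor \<open>p\<close>, the set on the left is the class of \<open>p\<close> just before \<open>N\<close> is added, and the first one on
  the right consists of the enemies of \<open>N\<close> in it; the last set is the class of \<open>q\<close> up to the factor \<open>q\<close>.
\<close>

lemma coprime_majority:
  fixes N :: nat
  assumes N: "N > 1" "\<not> prime N" "N < n0"
    and q: "q \<in> prime_factors N" "\<And>t. t \<in> prime_factors N \<Longrightarrow> q \<le> t"
    and p: "prime p" "p < q" and x: "x = (N - 1) div p"
  shows "card (sift (primes_below p) x) <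
    2 * card (sift (primes_below p \<union> prime_factors N) x) + card (sift (primes_below q) ((N - 1) div q))"
proof -
  have T: "p < t" if "t \<in> prime_factors N" for t using q(2)[OF that] p(2) by simp
  have "prime q" "q dvd N" using q(1) by auto
  hence "q < N" using N dvd_imp_le[of q N] by (cases "q = N") auto
  hence "1 \<in> sift (primes_below q) ((N - 1) div q)"
    using prime_gt_0_nat[OF \<open>prime q\<close>]
    by (auto simp: sift_def primes_below_def Suc_le_eq div_greater_zero_iff)
  \<comment> \<open>The class of \<open>q\<close> contains \<open>q\<close>, which turns weak
    majorities into strict ones.\<close>
  hence pos: "card (sift (primes_below q) ((N - 1) div q)) > 0" by (auto simp: card_gt_0_iff)
  have odd: "odd N"
  proof
    assume "even N"
    hence "2 \<in> prime_factors N" using N(1) by (simp add: in_prime_factors_iff)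
    from T[OF this] prime_ge_2_nat[OF p(1)] show False by simp
  qed
  consider "p = 2" | "p = 3" | "5 \<le> p"
    using p(1) prime_ge_2_nat[OF p(1)] by (cases "p = 4") (auto, linarith)
  thus ?thesis
  proof cases
    case 1
    thus ?thesis using coprime_majority_2[OF N(1,3) odd q] totient_eq_double_sift[OF odd N(1)]
      by (simp add: primes_below_small sift_empty x)
  next
    case 2
    note T = T[unfolded 2]
    from coprime_majority_3[OF N odd T x[unfolded 2]] show ?thesis
    proof
      assume "card (sift {2} x) \<le> 2 * card (sift ({2} \<union> prime_factors N) x)"
      with 2 pos show ?thesis unfolding 2 primes_below_small by linarith
    next
      assume *: "5 \<in> prime_factors N \<and> card (sift {2} x) < 2 * card (sift ({2} \<union> prime_factors N) x) + card (sift {2, 3} ((N - 1) div 5))"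
      have "3 < q" "q \<le> 5" "prime q" using * q T by auto
      hence "q = 5" by (cases "q = 4") auto
      with * 2 show ?thesis by (simp add: primes_below_small)
    qed
  next
    case 3
    with coprime_majority_ge_5[OF N p(1) 3 T x] pos show ?thesis by linarith
  qed
qed

text \<open>The quotient \<open>totient n0 / n0\<close> is about 0.327; the prime 23 brings it below
  1/3.\<close>

lemma totient_n0: "3 * totient n0 \<le> n0"
proof -
  have step: "totient (a * p) = totient a * (p - 1)" if "prime p" "\<not> p dvd a" for a p :: nat
    using that by (subst totient_mult_coprime)
      (auto simp: totient_prime coprime_commute[of a] prime_imp_coprime)
  have "totient (3 * 5 * 7 * 11 * 13 * 17 * 19 * 23) = totient (3 * 5 * 7 * 11 * 13 * 17 * 19) * (23 - 1)"
    by (rule step) simp_all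
  also have "totient (3 * 5 * 7 * 11 * 13 * 17 * 19) = totient (3 * 5 * 7 * 11 * 13 * 17) * (19 - 1)"
    by (rule step) simp_all
  also have "totient (3 * 5 * 7 * 11 * 13 * 17) = totient (3 * 5 * 7 * 11 * 13) * (17 - 1)"
    by (rule step) simp_all
  also have "totient (3 * 5 * 7 * 11 * 13) = totient (3 * 5 * 7 * 11) * (13 - 1)"
    by (rule step) simp_all
  also have "totient (3 * 5 * 7 * 11) = totient (3 * 5 * 7) * (11 - 1)"
    by (rule step) simp_all
  also have "totient (3 * 5 * 7) = totient (3 * 5) * (7 - 1)"
    by (rule step) simp_all
  also have "totient (3 * 5) = totient (3) * (5 - 1)"
    by (rule step) simp_all
  finally have "totient n0 = totient 3 * (5 - 1) * (7 - 1) * (11 - 1) * (13 - 1) * (17 - 1) * (19 - 1) * (23 - 1)"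
    by (simp only: n0_def)
  moreover have "totient 3 = 2" by (simp add: totient_prime)
  ultimately show ?thesis by (simp add: n0_def)
qed

section \<open>Classes by smallest prime factor\<close>

lemma nth_prime_prime: "prime (nth_prime i)"
  using enumerate_in_set[OF primes_infinite, of "i - 1"] by (simp add: nth_prime_def)

lemma nth_prime_less_iff: "1 \<le> i \<Longrightarrow> 1 \<le> j \<Longrightarrow> nth_prime i < nth_prime j \<longleftrightarrow> i < j"
  using primes_infinite by (auto simp: nth_prime_def)

lemma ex_nth_prime:
  assumes "prime p"
  obtains i where "1 \<le> i" "nth_prime i = p"
proof -
  obtain k where "enumerate {p. prime p} k = p"
    using enumerate_Ex[OF primes_infinite, of p] assms by auto
  thus ?thesis using that[of "Suc k"] by (simp add: nth_prime_def)
qed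

lemma primes_below_nth_prime:
  assumes "1 \<le> i"
  shows "primes_below (nth_prime i) = nth_prime ` {1..<i}"
proof (intro set_eqI iffI)
  fix l assume "l \<in> primes_below (nth_prime i)"
  hence "prime l" "l < nth_prime i" by (auto simp: primes_below_def)
  then obtain j where "1 \<le> j" "nth_prime j = l" using ex_nth_prime by blast
  thus "l \<in> nth_prime ` {1..<i}" using \<open>l < nth_prime i\<close> assms nth_prime_less_iff by force
qed (use assms nth_prime_less_iff in \<open>auto simp: primes_below_def nth_prime_prime\<close>)

lemma S_eq_multiples_in_sift:
  assumes "1 \<le> i"
  shows "S i n = {m \<in> sift (primes_below (nth_prime i)) n. nth_prime i dvd m}"
  unfolding primes_below_nth_prime[OF assms] by (auto simp: S_def sift_def)

text \<open>Division by the prime translates classes into sifted sets.\<close>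

lemma S_eq_image:
  assumes "1 \<le> i"
  shows "S i n = (*) (nth_prime i) ` sift (primes_below (nth_prime i)) (n div nth_prime i)"
  unfolding S_eq_multiples_in_sift[OF assms]
  by (rule multiples_in_sift) (auto simp: primes_below_def nth_prime_prime)

lemma inj_on_times_nth_prime: "inj_on ((*) (nth_prime i)) A"
  using nth_prime_prime[of i] by (auto simp: inj_on_def)

lemma card_S:
  assumes "1 \<le> i"
  shows "card (S i n) = card (sift (primes_below (nth_prime i)) (n div nth_prime i))"
  unfolding S_eq_image[OF assms] by (rule card_image) (rule inj_on_times_nth_prime)

lemma finite_S: "finite (S i n)"
  by (rule finite_subset[of _ "{..n}"]) (auto simp: S_def)

text \<open>For the larger prime the quotients have a shorter range and avoid more primes, so they
  are among the quotients for the smaller prime.\<close>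

lemma card_S_antimono:
  assumes "1 \<le> i" "i \<le> j"
  shows "card (S j n) \<le> card (S i n)"
proof -
  have le: "nth_prime i \<le> nth_prime j"
    using nth_prime_less_iff[of j i] assms by (metis le_trans not_less)
  have "n div nth_prime j \<le> n div nth_prime i"
    using le nth_prime_prime[of i] by (intro div_le_mono2 prime_gt_0_nat)
  hence "sift (primes_below (nth_prime j)) (n div nth_prime j) \<subseteq> sift (primes_below (nth_prime i)) (n div nth_prime i)"
    using le by (auto simp: sift_def primes_below_def)
  thus ?thesis using assms by (auto simp: card_S intro!: card_mono)
qed

lemma S_disjoint:
  assumes "1 \<le> i" "1 \<le> j" "i \<noteq> j"
  shows "S i m \<inter> S j n = {}"
  using assms by (cases i j rule: linorder_cases) (auto simp: S_def)

lemma S_Suc: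
  "S j (Suc n) = (if Suc n \<in> S j (Suc n) then S j n \<union> {Suc n} else S j n)"
  by (auto simp: S_def le_Suc_eq)

lemma self_mem_S_nth_prime:
  assumes "1 \<le> i"
  shows "nth_prime i \<in> S i n \<longleftrightarrow> nth_prime i \<le> n"
proof -
  have "\<not> nth_prime j dvd nth_prime i" if "1 \<le> j" "j < i" for j
    using that nth_prime_less_iff[of j i] primes_dvd_imp_eq[OF nth_prime_prime nth_prime_prime, of j i] by auto
  thus ?thesis using prime_ge_1_nat[OF nth_prime_prime, of i] by (auto simp: S_def)
qed

lemma S_eq_empty_iff:
  assumes "1 \<le> i"
  shows "S i n = {} \<longleftrightarrow> n < nth_prime i"
proof
  assume "n < nth_prime i"
  thus "S i n = {}" by (auto simp: S_def dest: dvd_imp_le)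
qed (use self_mem_S_nth_prime[OF assms, of n] in auto)

lemma ex_mem_S:
  assumes "2 \<le> m" "m \<le> n"
  obtains i where "1 \<le> i" "m \<in> S i n"
proof -
  define q where "q = (LEAST q. prime q \<and> q dvd m)"
  have "\<exists>q. prime q \<and> q dvd m" using prime_factor_nat[of m] assms(1) by auto
  hence q: "prime q" "q dvd m" unfolding q_def by (metis (mono_tags, lifting) LeastI_ex)+
  have least: "q \<le> l" if "prime l" "l dvd m" for l unfolding q_def using that by (intro Least_le) auto
  obtain i where i: "1 \<le> i" "nth_prime i = q" using ex_nth_prime[OF q(1)] by blast
  have "\<not> nth_prime j dvd m" if "1 \<le> j" "j < i" for j
    using least[OF nth_prime_prime, of j] nth_prime_less_iff[of j i] that i by auto
  hence "m \<in> S i n" using assms i q by (auto simp: S_def)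
  with i that show ?thesis by blast
qed

lemma S_mem_le_prime_factors:
  assumes "1 \<le> i" "m \<in> S i n" "t \<in> prime_factors m"
  shows "nth_prime i \<le> t"
proof -
  obtain j where j: "1 \<le> j" "nth_prime j = t" using ex_nth_prime[of t] assms(3) by auto
  hence "\<not> j < i" using assms(2,3) by (auto simp: S_def)
  thus ?thesis using nth_prime_less_iff[of j i] j assms(1) by auto
qed

lemma S_mem_prime_factor:
  assumes "m \<in> S i n"
  shows "nth_prime i \<in> prime_factors m"
  using assms nth_prime_prime[of i] by (auto simp: S_def in_prime_factors_iff)

section \<open>Costs of the options\<close>

definition friend_set :: "nat \<Rightarrow> nat set" where
  "friend_set n = {a. 2 \<le> a \<and> a < n \<and> gcd a n > 1}"

lemma option_cost_0:
  assumes "2 \<le> n" "\<Union>(set Ps) = {2..<n}"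
  shows "option_cost n Ps 0 = card (friend_set n)"
proof -
  have "in_conflict (set (apply_option n Ps 0)) a n \<longleftrightarrow> gcd a n > 1" if "2 \<le> a" "a < n" for a
  proof -
    have "n \<notin> C" if "C \<in> set Ps" for C using that assms(2) by auto
    moreover have "a \<in> \<Union>(set Ps)" using that assms(2) by simp
    then obtain C where "C \<in> set Ps" "a \<in> C" by blast
    ultimately show ?thesis using that assms(1)
      by (auto simp: in_conflict_def apply_option_def enemies_def friends_def)
  qed
  thus ?thesis unfolding option_cost_def friend_set_def by (metis (no_types, lifting))
qed

text \<open>The conflicts form the symmetric difference of the chosen class and the friends of
  \<open>n\<close>. The equation is additive to avoid truncated subtraction.\<close>

lemma option_cost_pos:
  assumes "2 \<le> n" "\<Union>(set Ps) = {2..<n}" "1 \<le> k" "k \<le> length Ps"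
    and disj: "\<And>i j. i < length Ps \<Longrightarrow> j < length Ps \<Longrightarrow> i \<noteq> j \<Longrightarrow> Ps ! i \<inter> Ps ! j = {}"
  shows "option_cost n Ps k + card (Ps ! (k - 1) \<inter> friend_set n) =
         card (friend_set n) + card (Ps ! (k - 1) - friend_set n)"
proof -
  define i where "i = k - 1"
  define P where "P = Ps ! i"
  define Qs where "Qs = Ps[i := P \<union> {n}]"
  define F where "F = friend_set n"
  have i: "i < length Ps" using assms by (simp add: i_def)
  have n: "n \<notin> Ps ! j" "Ps ! j \<subseteq> {2..<n}" if "j < length Ps" for j
    using that assms(2) nth_mem[OF that] by auto
  have Qs: "j < length Ps \<Longrightarrow> Qs ! j = (if j = i then P \<union> {n} else Ps ! j)" "length Qs = length Ps" for j
    by (auto simp: Qs_def nth_list_update)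
  have conf: "in_conflict (set (apply_option n Ps k)) a n \<longleftrightarrow> (if a \<in> P then gcd a n = 1 else gcd a n > 1)"
    if a: "2 \<le> a" "a < n" for a
  proof -
    have Q: "set (apply_option n Ps k) = (\<lambda>j. Qs ! j) ` {..<length Ps}"
      using assms(3) Qs(2) by (auto simp: apply_option_def Qs_def P_def i_def set_conv_nth)
    obtain j where j: "j < length Ps" "a \<in> Ps ! j"
    proof -
      have "a \<in> \<Union>(set Ps)" using a assms(2) by simp
      thus ?thesis using that by (auto simp: in_set_conv_nth)
    qed
    \<comment> \<open>After the update \<open>a\<close> still lies in exactly one class and
      \<open>n\<close> only in class \<open>i\<close>, so they share a class iff
      \<open>i = j\<close>.\<close>
    have mem: "a \<in> Qs ! l \<longleftrightarrow> l = j" "n \<in> Qs ! l \<longleftrightarrow> l = i" if "l < length Ps" for l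
      using that a disj[OF that j(1)] j n[OF that] by (auto simp: Qs P_def)
    have "(\<exists>C\<in>set (apply_option n Ps k). a \<in> C \<and> n \<in> C) \<longleftrightarrow> i = j"
      unfolding Q using mem i j(1) by auto
    moreover have "(\<exists>C\<in>set (apply_option n Ps k). \<exists>D\<in>set (apply_option n Ps k). C \<noteq> D \<and> a \<in> C \<and> n \<in> D) \<longleftrightarrow> i \<noteq> j"
      unfolding Q using mem i j(1) by (auto 4 4)
    moreover have "a \<in> P \<longleftrightarrow> i = j"
      using disj[OF i j(1)] j(2) by (auto simp: P_def)
    ultimately show ?thesis using a assms(1)
      by (auto simp: in_conflict_def enemies_def friends_def)
  qed
  have "P \<subseteq> {2..<n}" using n(2)[OF i] by (simp add: P_def)
  hence fin: "finite P" "finite F" by (auto simp: finite_subset F_def friend_set_def)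
  have "{a. 2 \<le> a \<and> a < n \<and> in_conflict (set (apply_option n Ps k)) a n} = (F - P) \<union> (P - F)"
  proof (rule set_eqI)
    fix a
    show "a \<in> {a. 2 \<le> a \<and> a < n \<and> in_conflict (set (apply_option n Ps k)) a n} \<longleftrightarrow> a \<in> (F - P) \<union> (P - F)"
    proof (cases "2 \<le> a \<and> a < n")
      case True
      moreover have "gcd a n > 1 \<longleftrightarrow> gcd a n \<noteq> 1" using assms(1) by (simp add: nat_neq_iff)
      ultimately show ?thesis using conf[of a] by (auto simp: F_def friend_set_def)
    next
      case False
      thus ?thesis using \<open>P \<subseteq> {2..<n}\<close> by (auto simp: F_def friend_set_def)
    qed
  qed
  hence "option_cost n Ps k = card (F - P) + card (P - F)"
    unfolding option_cost_def using fin by (simp add: card_Un_disjoint disjoint_iff)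
  moreover have "card F = card (F - P) + card (P \<inter> F)"
    using card_Int_Diff[OF fin(2), of P] by (simp add: Int_commute)
  ultimately show ?thesis by (simp add: F_def P_def i_def)
qed

text \<open>Strict inequality below \<open>k\<close> and weak inequality above it reflect the
  tie-breaking rule.\<close>

lemma best_option_eqI:
  assumes "k \<le> length Ps" "\<And>l. l < k \<Longrightarrow> option_cost n Ps k < option_cost n Ps l"
    and "\<And>l. k < l \<Longrightarrow> l \<le> length Ps \<Longrightarrow> option_cost n Ps k \<le> option_cost n Ps l"
  shows "best_option n Ps = k"
  unfolding best_option_def
proof (rule Least_equality)
  have "option_cost n Ps k \<le> option_cost n Ps l" if "l \<le> length Ps" for l
    using assms(2)[of l] assms(3)[of l] that by (cases l k rule: linorder_cases) auto
  thus "k \<le> length Ps \<and> (\<forall>l\<le>length Ps. option_cost n Ps k \<le> option_cost n Ps l)"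
    using assms(1) by blast
next
  fix l assume l: "l \<le> length Ps \<and> (\<forall>m\<le>length Ps. option_cost n Ps l \<le> option_cost n Ps m)"
  show "k \<le> l"
  proof (rule ccontr)
    assume "\<not> k \<le> l"
    with assms(2)[of l] l assms(1) show False by (meson not_le)
  qed
qed

section \<open>The greedy partition\<close>

text \<open>That is, \<open>c\<close> is the number of primes up to \<open>n\<close>.\<close>

definition prime_count :: "nat \<Rightarrow> nat \<Rightarrow> bool" where
  "prime_count n c \<longleftrightarrow> (\<forall>i\<ge>1. nth_prime i \<le> n \<longleftrightarrow> i \<le> c)"

text \<open>Ordering by primes is ordering by creation, since each class opens with its
  prime.\<close>

definition sieve_list :: "nat \<Rightarrow> nat \<Rightarrow> nat set list" where
  "sieve_list n c = map (\<lambda>j. S j n) [1..<Suc c]"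

lemma length_sieve_list [simp]: "length (sieve_list n c) = c"
  by (simp add: sieve_list_def)

lemma nth_sieve_list: "1 \<le> k \<Longrightarrow> k \<le> c \<Longrightarrow> sieve_list n c ! (k - Suc 0) = S k n"
  by (cases k) (simp_all add: sieve_list_def del: upt_Suc)

lemma set_sieve_list:
  assumes "prime_count n c"
  shows "set (sieve_list n c) = {S j n | j. 1 \<le> j \<and> S j n \<noteq> {}}"
proof -
  have "set (sieve_list n c) = {S j n | j. 1 \<le> j \<and> j \<le> c}" by (auto simp: sieve_list_def)
  also have "\<dots> = {S j n | j. 1 \<le> j \<and> S j n \<noteq> {}}"
    using assms by (intro Collect_cong) (metis S_eq_empty_iff not_less prime_count_def)
  finally show ?thesis .
qed

lemma S_ge_2:
  assumes "a \<in> S i n"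
  shows "2 \<le> a"
proof -
  have "nth_prime i \<le> a" using assms by (auto simp: S_def intro: dvd_imp_le)
  thus ?thesis using prime_ge_2_nat[OF nth_prime_prime, of i] by linarith
qed

lemma Union_sieve_list:
  assumes "prime_count n c"
  shows "\<Union>(set (sieve_list n c)) = {2..<Suc n}"
proof (intro set_eqI iffI)
  fix a assume "a \<in> {2..<Suc n}"
  then obtain i where "1 \<le> i" "a \<in> S i n" using ex_mem_S[of a n] by auto
  thus "a \<in> \<Union>(set (sieve_list n c))" unfolding set_sieve_list[OF assms] by blast
next
  fix a assume "a \<in> \<Union>(set (sieve_list n c))"
  then obtain j where "a \<in> S j n" unfolding set_sieve_list[OF assms] by blast
  thus "a \<in> {2..<Suc n}" using S_ge_2 by (auto simp: S_def)
qed

lemma sieve_list_disjoint: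
  assumes "i < c" "j < c" "i \<noteq> j"
  shows "sieve_list n c ! i \<inter> sieve_list n c ! j = {}"
  using nth_sieve_list[of "Suc i" c n] nth_sieve_list[of "Suc j" c n] S_disjoint[of "Suc i" "Suc j" n n] assms by simp

context
  fixes n c :: nat
  assumes n: "2 \<le> n" and c: "prime_count n c"
begin

lemma cost_new: "option_cost (Suc n) (sieve_list n c) 0 = card (friend_set (Suc n))"
  using n by (intro option_cost_0 Union_sieve_list[OF c]) auto

lemma cost_old:
  assumes "1 \<le> k" "k \<le> c"
  shows "option_cost (Suc n) (sieve_list n c) k + card (S k n \<inter> friend_set (Suc n)) =
         card (friend_set (Suc n)) + card (S k n - friend_set (Suc n))"
  using option_cost_pos[OF _ Union_sieve_list[OF c], of k] assms n sieve_list_disjoint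
  by (simp add: nth_sieve_list)

text \<open>Each friend in the class saves one conflict and each enemy adds one, so only the class
  size and the number of enemies matter.\<close>

lemma cost_old_card:
  assumes "1 \<le> k" "k \<le> c"
  shows "option_cost (Suc n) (sieve_list n c) k + card (S k n) =
         card (friend_set (Suc n)) + 2 * card (S k n - friend_set (Suc n))"
  using cost_old[OF assms] card_Int_Diff[OF finite_S, of k n "friend_set (Suc n)"] by linarith

lemma cost_dvd:
  assumes "1 \<le> k" "k \<le> c" "nth_prime k dvd Suc n"
  shows "option_cost (Suc n) (sieve_list n c) k + card (S k n) = card (friend_set (Suc n))"
proof -
  have "S k n \<subseteq> friend_set (Suc n)"
  proof
    fix a assume a: "a \<in> S k n"
    have "nth_prime k dvd gcd a (Suc n)" using a assms(3) by (auto simp: S_def)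
    hence "nth_prime k \<le> gcd a (Suc n)" by (intro dvd_imp_le) auto
    thus "a \<in> friend_set (Suc n)"
      using a S_ge_2[OF a] prime_gt_1_nat[OF nth_prime_prime, of k] by (auto simp: friend_set_def S_def)
  qed
  hence "S k n - friend_set (Suc n) = {}" by blast
  with cost_old_card[OF assms(1,2)] show ?thesis by simp
qed

text \<open>As \<open>p\<close> does not divide \<open>Suc n\<close>, dividing by \<open>p\<close>
  preserves coprimality with \<open>Suc n\<close>, and the enemies become a sifted set.\<close>

lemma cost_not_dvd:
  assumes "1 \<le> k" "k \<le> c" "\<not> nth_prime k dvd Suc n"
  defines "p \<equiv> nth_prime k"
  shows "option_cost (Suc n) (sieve_list n c) k + card (S k n) =
         card (friend_set (Suc n)) + 2 * card (sift (primes_below p \<union> prime_factors (Suc n)) (n div p))"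
proof -
  have cop: "coprime p (Suc n)" using assms(3) nth_prime_prime by (simp add: p_def prime_imp_coprime)
  have "S k n - friend_set (Suc n) = {a \<in> S k n. coprime a (Suc n)}"
  proof -
    have "a \<notin> friend_set (Suc n) \<longleftrightarrow> coprime a (Suc n)" if "a \<in> S k n" for a
    proof -
      have "gcd a (Suc n) > 1 \<longleftrightarrow> gcd a (Suc n) \<noteq> 1" by (simp add: nat_neq_iff)
      thus ?thesis using S_ge_2[OF that] that
        by (auto simp: friend_set_def S_def coprime_iff_gcd_eq_1)
    qed
    thus ?thesis by blast
  qed
  also have "\<dots> = (*) p ` {m \<in> sift (primes_below p) (n div p). coprime m (Suc n)}"
    unfolding S_eq_image[OF assms(1)] p_def[symmetric] using cop by auto
  also have "{m \<in> sift (primes_below p) (n div p). coprime m (Suc n)} = sift (primes_below p \<union> prime_factors (Suc n)) (n div p)"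
    by (auto simp: sift_def coprime_iff_no_prime_factor)
  finally have "card (S k n - friend_set (Suc n)) = card (sift (primes_below p \<union> prime_factors (Suc n)) (n div p))"
    by (simp add: card_image inj_on_times_nth_prime p_def)
  with cost_old_card[OF assms(1,2)] show ?thesis by simp
qed

text \<open>A prime has no smaller friends, so joining a class costs its full size and a new class
  costs nothing.\<close>

lemma best_option_prime:
  assumes "prime (Suc n)"
  shows "best_option (Suc n) (sieve_list n c) = 0"
proof (rule best_option_eqI)
  fix k assume k: "0 < k" "k \<le> length (sieve_list n c)"
  hence k': "1 \<le> k" "k \<le> c" by auto
  define p where "p = nth_prime k"
  have "p \<le> n" using c k' by (auto simp: prime_count_def p_def)
  have "\<not> p dvd Suc n"
    using primes_dvd_imp_eq[OF nth_prime_prime assms] \<open>p \<le> n\<close> by (force simp: p_def)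
  moreover have "sift (primes_below p \<union> prime_factors (Suc n)) (n div p) = sift (primes_below p) (n div p)"
  proof -
    have "\<not> Suc n dvd m" if "m \<in> sift Q (n div p)" for m Q
    proof -
      have "1 \<le> m" "m \<le> n" using that le_trans[OF _ div_le_dividend, of m n p] by (auto simp: sift_def)
      thus ?thesis by (auto dest: dvd_imp_le)
    qed
    thus ?thesis using prime_prime_factors[OF assms] by (auto simp: sift_def)
  qed
  ultimately have "option_cost (Suc n) (sieve_list n c) k = card (friend_set (Suc n)) + card (S k n)"
    using cost_not_dvd[OF k'] card_S[OF k'(1)] by (simp add: p_def)
  thus "option_cost (Suc n) (sieve_list n c) 0 \<le> option_cost (Suc n) (sieve_list n c) k"
    by (simp add: cost_new)
qed auto

text \<open>Earlier classes lose by \<open>coprime_majority\<close>. A later class saves at most its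
  size, which is no larger than that of class \<open>i\<close>, where all elements are
  friends.\<close>

lemma best_option_composite:
  assumes "\<not> prime (Suc n)" "Suc n < n0" "1 \<le> i" "Suc n \<in> S i (Suc n)"
  shows "best_option (Suc n) (sieve_list n c) = i" "i \<le> c"
proof -
  define q where "q = nth_prime i"
  define cost where "cost = option_cost (Suc n) (sieve_list n c)"
  have q: "q \<in> prime_factors (Suc n)" "\<And>t. t \<in> prime_factors (Suc n) \<Longrightarrow> q \<le> t"
    using S_mem_prime_factor[OF assms(4)] S_mem_le_prime_factors[OF assms(3,4)] by (auto simp: q_def)
  have "q dvd Suc n" "prime q" using q(1) by auto
  hence "q \<le> Suc n" "q \<noteq> Suc n" using assms(1) by (auto intro: dvd_imp_le)
  hence "q \<le> n" by simp
  thus "i \<le> c" using c assms(3) by (auto simp: prime_count_def q_def)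
  have cost_i: "cost i + card (S i n) = card (friend_set (Suc n))"
    unfolding cost_def by (rule cost_dvd) (use assms(3) \<open>i \<le> c\<close> \<open>q dvd Suc n\<close> in \<open>auto simp: q_def\<close>)
  have pos: "card (S i n) > 0"
    using self_mem_S_nth_prime[OF assms(3), of n] \<open>q \<le> n\<close> finite_S by (auto simp: card_gt_0_iff q_def)
  show "best_option (Suc n) (sieve_list n c) = i"
  proof (rule best_option_eqI)
    fix k assume "k < i"
    show "option_cost (Suc n) (sieve_list n c) i < option_cost (Suc n) (sieve_list n c) k"
    proof (cases "k = 0")
      case True
      thus ?thesis using cost_i pos by (simp add: cost_new cost_def)
    next
      case False
      hence k: "1 \<le> k" "k \<le> c" using \<open>k < i\<close> \<open>i \<le> c\<close> by auto
      define p where "p = nth_prime k"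
      have "p < q" using nth_prime_less_iff k(1) assms(3) \<open>k < i\<close> by (simp add: p_def q_def)
      have "\<not> p dvd Suc n" using assms(4) \<open>k < i\<close> k(1) by (auto simp: S_def p_def)
      hence "cost k + card (S k n) = card (friend_set (Suc n)) +
          2 * card (sift (primes_below p \<union> prime_factors (Suc n)) (n div p))"
        unfolding cost_def p_def using cost_not_dvd[OF k] by blast
      moreover have "card (S k n) < 2 * card (sift (primes_below p \<union> prime_factors (Suc n)) (n div p)) + card (S i n)"
        using coprime_majority[OF _ assms(1,2) q _ \<open>p < q\<close> refl] n nth_prime_prime[of k] card_S[OF k(1), of n] card_S[OF assms(3), of n]
        by (simp add: p_def q_def)
      ultimately show ?thesis using cost_i unfolding cost_def by linarith
    qed
  next
    fix k assume k: "i < k" "k \<le> length (sieve_list n c)"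
    hence k': "1 \<le> k" "k \<le> c" using assms(3) by auto
    have "card (S k n) \<le> card (S i n)" using card_S_antimono[OF assms(3)] k(1) by simp
    moreover have "card (S k n \<inter> friend_set (Suc n)) \<le> card (S k n)" by (intro card_mono finite_S) auto
    ultimately show "option_cost (Suc n) (sieve_list n c) i \<le> option_cost (Suc n) (sieve_list n c) k"
      using cost_i cost_old[OF k'] unfolding cost_def by linarith
  qed (use \<open>i \<le> c\<close> in simp)
qed

end

section \<open>Adding one number to the sorted classes, and the induction\<close>

lemma sieve_list_Suc_prime:
  assumes "prime_count n c" "prime (Suc n)"
  shows "prime_count (Suc n) (Suc c)" "sieve_list (Suc n) (Suc c) = sieve_list n c @ [{Suc n}]"
proof -
  obtain i where i: "1 \<le> i" "nth_prime i = Suc n" using ex_nth_prime[OF assms(2)] by blast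
  have le: "nth_prime j \<le> Suc n \<longleftrightarrow> j \<le> i" if "1 \<le> j" for j
    using nth_prime_less_iff[OF i(1) that] i(2) by (metis not_less)
  have less: "nth_prime j \<le> n \<longleftrightarrow> j < i" if "1 \<le> j" for j
    using nth_prime_less_iff[OF that i(1)] i(2) by (simp add: less_Suc_eq_le)
  have "j \<le> c \<longleftrightarrow> j < i" if "1 \<le> j" for j
    using less[OF that] assms(1) that by (auto simp: prime_count_def)
  \<comment> \<open>These three instances force the new prime to be the one right after the first
    \<open>c\<close>.\<close>
  from this[of c] this[of "Suc c"] this[of i] i(1) have "i = Suc c" by (cases c) auto
  with le show "prime_count (Suc n) (Suc c)" by (simp add: prime_count_def)
  have "S j (Suc n) = S j n" if "1 \<le> j" "j \<le> c" for j
  proof -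
    have "nth_prime j \<le> n" using that assms(1) by (auto simp: prime_count_def)
    hence "\<not> nth_prime j dvd Suc n" using primes_dvd_imp_eq[OF nth_prime_prime[of j] assms(2)] by auto
    thus ?thesis using S_Suc[of j n] by (auto simp: S_def)
  qed
  moreover have "S (Suc c) (Suc n) = {Suc n}"
  proof -
    have "S (Suc c) n = {}" using S_eq_empty_iff[of "Suc c" n] i \<open>i = Suc c\<close> by simp
    moreover have "Suc n \<in> S (Suc c) (Suc n)" using self_mem_S_nth_prime[OF i(1), of "Suc n"] i(2) \<open>i = Suc c\<close> by simp
    ultimately show ?thesis using S_Suc[of "Suc c" n] by simp
  qed
  ultimately show "sieve_list (Suc n) (Suc c) = sieve_list n c @ [{Suc n}]"
    by (auto simp: sieve_list_def)
qed

lemma sieve_list_Suc_composite: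
  assumes "prime_count n c" "\<not> prime (Suc n)" "1 \<le> i" "i \<le> c" "Suc n \<in> S i (Suc n)"
  shows "prime_count (Suc n) c" "sieve_list (Suc n) c = (sieve_list n c)[i - 1 := S i n \<union> {Suc n}]"
proof -
  have "nth_prime j \<noteq> Suc n" for j using nth_prime_prime[of j] assms(2) by auto
  thus "prime_count (Suc n) c" using assms(1) by (auto simp: prime_count_def le_Suc_eq)
  show "sieve_list (Suc n) c = (sieve_list n c)[i - 1 := S i n \<union> {Suc n}]"
  proof (rule nth_equalityI)
    fix j assume "j < length (sieve_list (Suc n) c)"
    hence j: "j < c" by simp
    have "Suc n \<in> S (Suc j) (Suc n) \<longleftrightarrow> Suc j = i"
      using S_disjoint[of "Suc j" i "Suc n" "Suc n"] assms(3,5) by auto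
    hence "S (Suc j) (Suc n) = (if Suc j = i then S i n \<union> {Suc n} else S (Suc j) n)"
      using S_Suc[of "Suc j" n] by simp
    moreover have "sieve_list m c ! j = S (Suc j) m" for m
      using nth_sieve_list[of "Suc j" c m] j by simp
    moreover have "Suc j = i \<longleftrightarrow> i - 1 = j" using assms(3) by auto
    ultimately show "sieve_list (Suc n) c ! j = (sieve_list n c)[i - 1 := S i n \<union> {Suc n}] ! j"
      using j by (simp add: nth_list_update)
  qed simp
qed

lemma nth_prime_1: "nth_prime 1 = 2"
proof -
  obtain i where i: "1 \<le> i" "nth_prime i = 2" using ex_nth_prime[OF two_is_prime_nat] by blast
  hence "\<not> 1 < i" using nth_prime_less_iff[of 1 i] prime_ge_2_nat[OF nth_prime_prime, of 1] by auto
  with i show ?thesis by (metis le_antisym not_less)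
qed

lemma nth_prime_2: "nth_prime 2 = 3"
proof -
  have "prime (3::nat)" by simp
  then obtain i where i: "1 \<le> i" "nth_prime i = 3" using ex_nth_prime by blast
  have "nth_prime 2 > 2" using nth_prime_less_iff[of 1 2] nth_prime_1 by simp
  hence "\<not> 2 < i" using nth_prime_less_iff[of 2 i] i by auto
  moreover have "i \<noteq> 1" using i nth_prime_1 by auto
  ultimately have "i = 2" using i(1) by linarith
  with i show ?thesis by simp
qed

lemma greedy_eq_sieve_list:
  assumes "2 \<le> m" "m < n0"
  shows "\<exists>c. prime_count m c \<and> greedy m = sieve_list m c"
  using assms
proof (induction m rule: dec_induct)
  case base
  have "prime_count 2 1"
    unfolding prime_count_def
  proof (intro allI impI)
    fix i :: nat assume "i \<ge> 1"
    thus "nth_prime i \<le> 2 \<longleftrightarrow> i \<le> 1"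
      using nth_prime_less_iff[of 1 i] nth_prime_1 by (metis le_refl not_less)
  qed
  moreover have "S 1 2 = {2}"
    using S_ge_2[of _ 1 2] self_mem_S_nth_prime[of 1 2] nth_prime_1 by (auto simp: S_def le_antisym)
  hence "greedy 2 = sieve_list 2 1" by (simp add: sieve_list_def numeral_2_eq_2)
  ultimately show ?case by blast
next
  case (step n)
  then obtain c where c: "prime_count n c" "greedy n = sieve_list n c" by auto
  have greedy: "greedy (Suc n) = apply_option (Suc n) (sieve_list n c) (best_option (Suc n) (sieve_list n c))"
    using c(2) step.hyps by simp
  show ?case
  proof (cases "prime (Suc n)")
    case True
    hence "greedy (Suc n) = sieve_list (Suc n) (Suc c)"
      using greedy best_option_prime[OF step.hyps(1) c(1) True] sieve_list_Suc_prime(2)[OF c(1) True]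
      by (simp add: apply_option_def)
    thus ?thesis using sieve_list_Suc_prime(1)[OF c(1) True] by blast
  next
    case False
    obtain i where i: "1 \<le> i" "Suc n \<in> S i (Suc n)"
      using ex_mem_S[of "Suc n" "Suc n"] step.hyps by auto
    note best = best_option_composite[OF step.hyps(1) c(1) False step.prems i]
    have "greedy (Suc n) = sieve_list (Suc n) c"
      using greedy best i(1) sieve_list_Suc_composite(2)[OF c(1) False i(1) best(2) i(2)]
      by (simp add: apply_option_def nth_sieve_list)
    thus ?thesis using sieve_list_Suc_composite(1)[OF c(1) False i(1) best(2) i(2)] by blast
  qed
qed

text \<open>By \<open>totient_n0\<close> the class of 2 is at least as good as that of 3, and a tie
  would go to the smaller index. Classes of larger primes are no bigger than the class of 3, all of
  whose elements are friends of \<open>n0\<close>.\<close>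

lemma best_option_n0:
  assumes c: "prime_count (n0 - 1) c"
  shows "best_option n0 (sieve_list (n0 - 1) c) = 1" "2 \<le> c"
proof -
  define n where "n = n0 - 1"
  have n: "Suc n = n0" "2 \<le> n" by (simp_all add: n_def n0_def)
  note c = c[folded n_def]
  have "nth_prime 2 \<le> n" by (simp add: nth_prime_2 n_def n0_def)
  thus "2 \<le> c" using c by (simp add: prime_count_def)
  have cost2: "option_cost n0 (sieve_list n c) 2 + card (S 2 n) = card (friend_set n0)"
    using cost_dvd[OF n(2) c, of 2] \<open>2 \<le> c\<close> nth_prime_2 n(1) by (simp add: n0_def)
  have odd: "odd n0" by (simp add: n0_def)
  have "2 * card (sift (prime_factors n0) ((n0 - 1) div 2)) = totient n0"
    using totient_eq_double_sift[OF odd] by (simp add: n0_def)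
  hence cost1: "option_cost n0 (sieve_list n c) 1 + card (S 1 n) = card (friend_set n0) + totient n0"
    using cost_not_dvd[OF n(2) c, of 1] \<open>2 \<le> c\<close> nth_prime_1 n(1) odd
    by (simp add: primes_below_small n_def)
  have card1: "card (S 1 n) = (n0 - 1) div 2"
    by (simp add: card_S nth_prime_1 primes_below_small sift_empty n_def del: One_nat_def)
  have card2: "card (S 2 n) = ((n0 - 1) div 3 + 1) div 2"
    by (simp add: card_S nth_prime_2 primes_below_small card_odd_upto n_def del: One_nat_def)
  \<comment> \<open>The two class sizes differ by exactly \<open>n0 / 3\<close>.\<close>
  have "totient n0 + card (S 2 n) \<le> card (S 1 n)"
    unfolding card1 card2 using totient_n0 by (simp add: n0_def)
  hence le: "option_cost n0 (sieve_list n c) 1 \<le> option_cost n0 (sieve_list n c) 2"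
    using cost1 cost2 by linarith
  have "best_option n0 (sieve_list n c) = 1"
  proof (rule best_option_eqI)
    fix k :: nat assume "k < 1"
    have "card (S 2 n) > 0" unfolding card2 by (simp add: n0_def)
    thus "option_cost n0 (sieve_list n c) 1 < option_cost n0 (sieve_list n c) k"
      using \<open>k < 1\<close> le cost2 cost_new[OF n(2) c] n(1) by simp
  next
    fix k assume k: "1 < k" "k \<le> length (sieve_list n c)"
    have "card (S k n) \<le> card (S 2 n)" using card_S_antimono[of 2 k] k(1) by simp
    moreover have "card (S k n \<inter> friend_set n0) \<le> card (S k n)" by (intro card_mono finite_S) auto
    ultimately show "option_cost n0 (sieve_list n c) 1 \<le> option_cost n0 (sieve_list n c) k"
      using le cost2 cost_old[OF n(2) c, of k] k n(1) by simp
  qed (use \<open>2 \<le> c\<close> in simp)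
  thus "best_option n0 (sieve_list (n0 - 1) c) = 1" by (simp add: n_def)
qed

theorem theorem1:
  "n0 = 111546435 \<and>
   (\<forall>m. 2 \<le> m \<and> m < n0 \<longrightarrow> G m = {S j m | j. 1 \<le> j \<and> S j m \<noteq> {}}) \<and>
   G n0 = {S 1 n0 \<union> {n0}, S 2 n0 - {n0}} \<union> {S j n0 | j. 3 \<le> j \<and> S j n0 \<noteq> {}}"
proof (intro conjI allI impI)
  show "n0 = 111546435" by (simp add: n0_def)
next
  fix m assume m: "2 \<le> m \<and> m < n0"
  then obtain c where "prime_count m c" "greedy m = sieve_list m c" using greedy_eq_sieve_list by blast
  thus "G m = {S j m | j. 1 \<le> j \<and> S j m \<noteq> {}}" by (simp add: G_def set_sieve_list)
next
  define n where "n = n0 - 1"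
  have n: "Suc n = n0" "2 \<le> n" "n < n0" by (simp_all add: n_def n0_def)
  obtain c where c: "prime_count n c" "greedy n = sieve_list n c" using greedy_eq_sieve_list n by blast
  note best = best_option_n0[OF c(1)[unfolded n_def], folded n_def]
  have "greedy n0 = apply_option n0 (sieve_list n c) 1"
    using c(2) n best(1) greedy.simps(2)[of n] by simp
  also have "\<dots> = (sieve_list n c)[0 := S 1 n \<union> {n0}]"
    using nth_sieve_list[of 1 c n] best(2) by (simp add: apply_option_def)
  also have "sieve_list n c = S 1 n # S 2 n # map (\<lambda>j. S j n) [3..<Suc c]"
    using best(2) by (simp add: sieve_list_def upt_conv_Cons numeral_2_eq_2 numeral_3_eq_3 del: upt_Suc)
  finally have "G n0 = {S 1 n \<union> {n0}, S 2 n} \<union> {S j n | j. 3 \<le> j \<and> j \<le> c}"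
    by (auto simp: G_def)
  have no: "n0 \<notin> S j n" for j using n by (auto simp: S_def)
  have "n0 \<in> S 2 n0"
  proof -
    have "\<not> nth_prime j dvd n0" if "1 \<le> j" "j < 2" for j
      using that nth_prime_1 by (simp add: less_2_cases_iff n0_def)
    thus ?thesis by (auto simp: S_def nth_prime_2 n0_def)
  qed
  hence mem: "n0 \<in> S j n0 \<longleftrightarrow> j = 2" if "1 \<le> j" for j
    using S_disjoint[of j 2 n0 n0] that by auto
  \<comment> \<open>Only the class of 3 differs between \<open>n\<close> and \<open>n0\<close>;
    hence \<open>S 2 n\<close> is \<open>S 2 n0 - {n0}\<close>.\<close>
  have S: "S j n0 = (if j = 2 then S 2 n \<union> {n0} else S j n)" if "1 \<le> j" for j
    using S_Suc[of j n] mem[OF that] n(1) by simp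
  have empty: "S j n = {} \<longleftrightarrow> \<not> j \<le> c" if "3 \<le> j" for j
    using S_eq_empty_iff[of j n] c(1)[unfolded prime_count_def, rule_format, of j] that by auto
  have S_ge_3: "S j n0 = S j n" if "3 \<le> j" for j
    using S[of j] that by simp
  have "{S j n | j. 3 \<le> j \<and> j \<le> c} = {S j n0 | j. 3 \<le> j \<and> S j n0 \<noteq> {}}"
    by (intro Collect_cong ex_cong1) (metis S_ge_3 empty)
  thus "G n0 = {S 1 n0 \<union> {n0}, S 2 n0 - {n0}} \<union> {S j n0 | j. 3 \<le> j \<and> S j n0 \<noteq> {}}"
    using \<open>G n0 = _\<close> S[of 1] S[of 2] no by auto
qed

end
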